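(* Let $K$ be a field (of any characteristic), $S=K[x_1,\dots,x_n]$, $d\ge2$, $\mathbf t=(t_1,\dots,t_{d-1})\in\mathbb Z_{\ge0}^{d-1}$, and let $I\subset S$ be a proper $\mathbf t$-spread strongly stable ideal. Then $$\beta_{i,i+j}(I)=\sum_{u\in G(I)_j}\binom{\max(u)-1-\sum_{\ell=1}^{j-1}t_\ell}{i}\qquad\text{for all } i,j\ge0.$$ In particular, the graded Betti numbers of $I$ do not depend upon the characteristic of the field $K$.
   Context: A monomial $u=x_{j_1}\cdots x_{j_\ell}\in S$ with $j_1\le\dots\le j_\ell$ and $\ell\le d$ is $\mathbf t$-spread if $j_{r+1}-j_r\ge t_r$ for all $r=1,\dots,\ell-1$ (variables and $1$ are $\mathbf t$-spread). $G(I)$ denotes the minimal monomial generating set of a monomial ideal $I$, and $G(I)_j=\{u\in G(I):\deg(u)=j\}$. $I$ is a $\mathbf t$-spread monomial ideal if all $u\in G(I)$ are $\mathbf t$-spread; it is $\mathbf t$-spread strongly stable if moreover, for every $\mathbf t$-spread monomial $u\in I$ and all $j<i$ with $x_i\mid u$ and $x_j(u/x_i)$ $\mathbf t$-spread, one has $x_j(u/x_i)\in I$. $\max(u)=\max\{i:x_i\mid u\}$. $\beta_{i,j}(I)=\dim_K\operatorname{Tor}_i^S(K,I)_j$ are the graded Betti numbers. *)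

theory Defs
  imports Complex_Main "HOL-Library.Poly_Mapping" "HOL-Library.Function_Algebras"
begin

section \<open>The polynomial ring and monomial ideals\<close>

text \<open>
  A monomial is its exponent vector; the exponent of \<open>x_i\<close> in \<open>u\<close> is
  \<open>Poly_Mapping.lookup u i\<close>, and \<open>u + v\<close> is the product of monomials. \<open>S = K[x_1,\<dots>,x_n]\<close> is the
  subring \<open>poly_ring n\<close> of the polynomials that only involve the variables \<open>x_1,\<dots>,x_n\<close>.
\<close>

type_synonym monom = "nat \<Rightarrow>\<^sub>0 nat"
type_synonym 'k mpol = "monom \<Rightarrow>\<^sub>0 'k"

definition monoms :: "nat \<Rightarrow> monom set" where
  "monoms n = {u. Poly_Mapping.keys u \<subseteq> {1..n}}"

definition poly_ring :: "nat \<Rightarrow> 'k::field mpol set" where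
  "poly_ring n = {p. Poly_Mapping.keys p \<subseteq> monoms n}"

definition xmon :: "monom \<Rightarrow> 'k::field mpol" where
  "xmon u = Poly_Mapping.single u 1"

definition mdeg :: "monom \<Rightarrow> nat" where
  "mdeg u = (\<Sum>i\<in>Poly_Mapping.keys u. Poly_Mapping.lookup u i)"

definition max_var :: "monom \<Rightarrow> nat" where
  "max_var u = Max (Poly_Mapping.keys u)"

definition is_ideal :: "nat \<Rightarrow> 'k::field mpol set \<Rightarrow> bool" where
  "is_ideal n I \<longleftrightarrow> I \<subseteq> poly_ring n \<and> 0 \<in> I \<and>
     (\<forall>p\<in>I. \<forall>q\<in>I. p + q \<in> I) \<and> (\<forall>s\<in>poly_ring n. \<forall>p\<in>I. s * p \<in> I)"

definition monom_ideal :: "nat \<Rightarrow> monom set \<Rightarrow> 'k::field mpol set" where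
  "monom_ideal n M = is_ideal n hull (xmon ` M)"

definition is_monomial_ideal :: "nat \<Rightarrow> 'k::field mpol set \<Rightarrow> bool" where
  "is_monomial_ideal n I \<longleftrightarrow> (\<exists>M\<subseteq>monoms n. I = monom_ideal n M)"

text \<open>The (unique) minimal monomial generating set \<open>G(I)\<close> of a monomial ideal.\<close>

definition min_gens :: "nat \<Rightarrow> 'k::field mpol set \<Rightarrow> monom set" where
  "min_gens n I = (THE G. G \<subseteq> monoms n \<and> monom_ideal n G = I \<and>
                          (\<forall>H. H \<subset> G \<longrightarrow> monom_ideal n H \<noteq> I))"


section \<open>Spread strongly stable ideals\<close>

text \<open>
  The sequence \<open>t_1,\<dots>,t_{d-1}\<close> is given by a function of which only the values at \<open>1,\<dots>,d-1\<close>
  are used. The list index starts at 0, so \<open>js ! (r - 1)\<close> is \<open>j_r\<close>.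
\<close>

definition tspread :: "nat \<Rightarrow> (nat \<Rightarrow> nat) \<Rightarrow> monom \<Rightarrow> bool" where
  "tspread d t u \<longleftrightarrow>
     (\<exists>js. sorted js \<and> length js \<le> d \<and> u = (\<Sum>j\<leftarrow>js. Poly_Mapping.single j 1) \<and>
           (\<forall>r. 1 \<le> r \<and> r < length js \<longrightarrow> js ! (r - 1) + t r \<le> js ! r))"

definition tspread_ideal :: "nat \<Rightarrow> nat \<Rightarrow> (nat \<Rightarrow> nat) \<Rightarrow> 'k::field mpol set \<Rightarrow> bool" where
  "tspread_ideal n d t I \<longleftrightarrow> is_monomial_ideal n I \<and> (\<forall>u\<in>min_gens n I. tspread d t u)"

definition tspread_strongly_stable ::
    "nat \<Rightarrow> nat \<Rightarrow> (nat \<Rightarrow> nat) \<Rightarrow> 'k::field mpol set \<Rightarrow> bool" where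
  "tspread_strongly_stable n d t I \<longleftrightarrow> tspread_ideal n d t I \<and>
     (\<forall>u i j. xmon u \<in> I \<and> tspread d t u \<and> 1 \<le> j \<and> j < i \<and> i \<in> Poly_Mapping.keys u \<and>
        tspread d t (Poly_Mapping.single j 1 + (u - Poly_Mapping.single i 1)) \<longrightarrow>
        xmon (Poly_Mapping.single j 1 + (u - Poly_Mapping.single i 1)) \<in> I)"


section \<open>Graded free resolutions, Tor, and graded Betti numbers\<close>

text \<open>
  The data of a complex \<open>\<cdots> \<rightarrow> F_1 \<rightarrow> F_0 \<rightarrow> I\<close> of finitely generated graded free modules
  \<open>F_i = S(-shift i 0) \<oplus> \<cdots> \<oplus> S(-shift i (frank i - 1))\<close>: the map \<open>F_{i+1} \<rightarrow> F_i\<close> is the matrix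
  with entries \<open>diff i a b\<close> (row \<open>a\<close>, column \<open>b\<close>), and the \<open>b\<close>-th basis element of \<open>F_0\<close> is sent
  to \<open>aug b\<close>. Ideals of \<open>S\<close> live in nonnegative degrees, so natural-number shifts suffice.
\<close>

record (overloaded) 'k free_complex =
  frank :: "nat \<Rightarrow> nat"
  shift :: "nat \<Rightarrow> nat \<Rightarrow> nat"
  diff :: "nat \<Rightarrow> nat \<Rightarrow> nat \<Rightarrow> 'k mpol"
  aug :: "nat \<Rightarrow> 'k mpol"

definition free_mod :: "nat \<Rightarrow> nat \<Rightarrow> (nat \<Rightarrow> 'k::field mpol) set" where
  "free_mod n r = {v. \<forall>b. if b < r then v b \<in> poly_ring n else v b = 0}"

text \<open>Multiplication of a column vector by a matrix with \<open>r\<close> rows and \<open>s\<close> columns.\<close>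

definition mat_app ::
    "nat \<Rightarrow> nat \<Rightarrow> (nat \<Rightarrow> nat \<Rightarrow> 'a::comm_ring_1) \<Rightarrow> (nat \<Rightarrow> 'a) \<Rightarrow> nat \<Rightarrow> 'a" where
  "mat_app r s A v = (\<lambda>a. if a < r then (\<Sum>b<s. A a b * v b) else 0)"

definition diff_map :: "'k::field free_complex \<Rightarrow> nat \<Rightarrow> (nat \<Rightarrow> 'k mpol) \<Rightarrow> nat \<Rightarrow> 'k mpol" where
  "diff_map F i = mat_app (frank F i) (frank F (Suc i)) (diff F i)"

definition aug_map :: "'k::field free_complex \<Rightarrow> (nat \<Rightarrow> 'k mpol) \<Rightarrow> 'k mpol" where
  "aug_map F v = (\<Sum>b<frank F 0. v b * aug F b)"

definition graded_free_resolution :: "nat \<Rightarrow> 'k::field mpol set \<Rightarrow> 'k free_complex \<Rightarrow> bool" where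
  "graded_free_resolution n I F \<longleftrightarrow>
     (\<forall>b<frank F 0. aug F b \<in> poly_ring n \<and>
        (\<forall>u\<in>Poly_Mapping.keys (aug F b). mdeg u = shift F 0 b)) \<and>
     (\<forall>i. \<forall>a<frank F i. \<forall>b<frank F (Suc i). diff F i a b \<in> poly_ring n \<and>
        (\<forall>u\<in>Poly_Mapping.keys (diff F i a b). mdeg u + shift F i a = shift F (Suc i) b)) \<and>
     aug_map F ` free_mod n (frank F 0) = I \<and>
     {v \<in> free_mod n (frank F 0). aug_map F v = 0} = diff_map F 0 ` free_mod n (frank F 1) \<and>
     (\<forall>i. {v \<in> free_mod n (frank F (Suc i)). diff_map F i v = 0} =
          diff_map F (Suc i) ` free_mod n (frank F (Suc (Suc i))))"

text \<open>
  \<open>K = S/(x_1,\<dots>,x_n)\<close>, so \<open>K \<otimes> F_i\<close> is the graded \<open>K\<close>-vector space with the same basis in the same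
  degrees, and \<open>K \<otimes> diff i\<close> is the matrix of constant terms. \<open>tensor_part F i j\<close> is its component
  of degree \<open>j\<close>, and \<open>Tor_i(K, I)_j\<close> is the quotient of \<open>tensor_cycles F i j\<close> by
  \<open>tensor_bounds F i j\<close>.
\<close>

definition tensor_part :: "'k::field free_complex \<Rightarrow> nat \<Rightarrow> nat \<Rightarrow> (nat \<Rightarrow> 'k) set" where
  "tensor_part F i j = {v. \<forall>b. v b \<noteq> 0 \<longrightarrow> b < frank F i \<and> shift F i b = j}"

definition tensor_diff :: "'k::field free_complex \<Rightarrow> nat \<Rightarrow> (nat \<Rightarrow> 'k) \<Rightarrow> nat \<Rightarrow> 'k" where
  "tensor_diff F i = mat_app (frank F i) (frank F (Suc i))
     (\<lambda>a b. Poly_Mapping.lookup (diff F i a b) 0)"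

definition tensor_cycles :: "'k::field free_complex \<Rightarrow> nat \<Rightarrow> nat \<Rightarrow> (nat \<Rightarrow> 'k) set" where
  "tensor_cycles F i j = {v \<in> tensor_part F i j. case i of 0 \<Rightarrow> True | Suc k \<Rightarrow> tensor_diff F k v = 0}"

definition tensor_bounds :: "'k::field free_complex \<Rightarrow> nat \<Rightarrow> nat \<Rightarrow> (nat \<Rightarrow> 'k) set" where
  "tensor_bounds F i j = tensor_diff F i ` tensor_part F (Suc i) j"

abbreviation fdim :: "(nat \<Rightarrow> 'k::field) set \<Rightarrow> nat" where
  "fdim \<equiv> vector_space.dim (\<lambda>c v b. c * v b)"

definition tor_dim :: "'k::field free_complex \<Rightarrow> nat \<Rightarrow> nat \<Rightarrow> nat" where
  "tor_dim F i j = fdim (tensor_cycles F i j) - fdim (tensor_bounds F i j)"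

text \<open>
  \<open>betti n I i j = dim_K Tor_i(K, I)_j\<close> over \<open>S = K[x_1,\<dots>,x_n]\<close>, where \<open>K\<close> is the coefficient type
  of \<open>I\<close>. As usual for Tor, the resolution of \<open>I\<close> is an arbitrary one.
\<close>

definition betti :: "nat \<Rightarrow> 'k::field mpol set \<Rightarrow> nat \<Rightarrow> nat \<Rightarrow> nat" where
  "betti n I i j = tor_dim (SOME F. graded_free_resolution n I F) i j"

end

(* A t-spread strongly stable ideal has linear quotients. Order G(I) by degree and then
   lexicographically by the sorted list of indices; for u = x_{j_1}...x_{j_l} in G(I) the colon of
   the ideal generated by the predecessors of u by u is generated by the variables x_k with
   k < max(u) and k outside all the intervals [j_r, j_r + t_r - 1]. These intervals are disjoint, so
   there are max(u) - 1 - (t_1 + ... + t_{l-1}) such variables. Adding u to the ideal of its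
   predecessors therefore amounts to a mapping cone with a Koszul complex, and the cone is again
   minimal because the degrees of its comparison map are too large for constant entries. So I has
   an explicit minimal resolution; Tor does not depend on the resolution by the comparison theorem.
*)

theory Submission
  imports Defs "HOL-Library.List_Lexorder" "HOL-Library.Multiset"
begin

section \<open>Polynomials and their homogeneous parts\<close>

abbreviation "keys \<equiv> Poly_Mapping.keys"
abbreviation "lookup \<equiv> Poly_Mapping.lookup"

lemma mdeg_eq_sum: "finite A \<Longrightarrow> keys u \<subseteq> A \<Longrightarrow> mdeg u = (\<Sum>i\<in>A. lookup u i)"
  unfolding mdeg_def by (rule sum.mono_neutral_left) (auto simp: in_keys_iff)

lemma mdeg_zero [simp]: "mdeg 0 = 0"
  by (simp add: mdeg_def)

lemma mdeg_single [simp]: "mdeg (Poly_Mapping.single i c) = c"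
  by (simp add: mdeg_def)

text \<open>Natural exponents cannot cancel, so the inclusion valid for general coefficients becomes
  an equality.\<close>

lemma keys_add_nat: "keys (u + v) = keys u \<union> keys v" for u v :: monom
  by (auto simp: in_keys_iff lookup_add)

lemma mdeg_add: "mdeg (u + v) = mdeg u + mdeg v"
  by (simp add: mdeg_eq_sum[of "keys u \<union> keys v"] keys_add_nat lookup_add sum.distrib)

lemma mdeg_eq_0_iff [simp]: "mdeg u = 0 \<longleftrightarrow> u = 0"
  by (auto simp: mdeg_def in_keys_iff intro!: poly_mapping_eqI)

lemma mpol_expand: "p = (\<Sum>u\<in>keys p. Poly_Mapping.single u (lookup p u))"
  by (rule poly_mapping_eqI) (simp add: lookup_sum lookup_single when_def in_keys_iff)

lemma monoms_add [simp]: "u + v \<in> monoms n \<longleftrightarrow> u \<in> monoms n \<and> v \<in> monoms n"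
  by (auto simp: monoms_def keys_add_nat)

lemma monoms_zero [simp]: "0 \<in> monoms n"
  by (simp add: monoms_def)

lemma poly_ring_zero [simp]: "0 \<in> poly_ring n"
  and poly_ring_one [simp]: "1 \<in> poly_ring n"
  by (auto simp: poly_ring_def)

lemma poly_ring_single: "u \<in> monoms n \<Longrightarrow> Poly_Mapping.single u c \<in> poly_ring n"
  by (auto simp: poly_ring_def)

lemma poly_ring_add: "p \<in> poly_ring n \<Longrightarrow> q \<in> poly_ring n \<Longrightarrow> p + q \<in> poly_ring n"
  using Poly_Mapping.keys_add[of p q] by (auto simp: poly_ring_def)

lemma poly_ring_mult: "p \<in> poly_ring n \<Longrightarrow> q \<in> poly_ring n \<Longrightarrow> p * q \<in> poly_ring n"
  using Poly_Mapping.keys_mult[of p q] by (fastforce simp: poly_ring_def)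

lemma poly_ring_uminus: "p \<in> poly_ring n \<Longrightarrow> - p \<in> poly_ring n"
  by (simp add: poly_ring_def)

lemma poly_ring_minus: "p \<in> poly_ring n \<Longrightarrow> q \<in> poly_ring n \<Longrightarrow> p - q \<in> poly_ring n"
  using poly_ring_add[of p n "- q"] by (simp add: poly_ring_uminus)

lemma poly_ring_sum: "(\<And>x. x \<in> A \<Longrightarrow> f x \<in> poly_ring n) \<Longrightarrow> sum f A \<in> poly_ring n"
  by (induction A rule: infinite_finite_induct) (auto intro: poly_ring_add)

text \<open>With a degree condition as \<open>P\<close> this extracts a homogeneous component. The
  predicate is kept general because the condition changes when a homogeneous factor is pulled out,
  see \<open>part_mult\<close>.\<close>

definition part :: "(monom \<Rightarrow> bool) \<Rightarrow> 'k::field mpol \<Rightarrow> 'k mpol" where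
  "part P = Poly_Mapping.mapp (\<lambda>u c. if P u then c else 0)"

lemma lookup_part: "lookup (part P p) u = (if P u then lookup p u else 0)"
  by (auto simp: part_def lookup_mapp when_def in_keys_iff)

lemma keys_part: "keys (part P p) = {u \<in> keys p. P u}"
  by (auto simp: in_keys_iff lookup_part split: if_splits)

lemma part_add: "part P (p + q) = part P p + part P q"
  by (rule poly_mapping_eqI) (simp add: lookup_part lookup_add)

lemma part_zero [simp]: "part P 0 = 0"
  by (rule poly_mapping_eqI) (simp add: lookup_part)

lemma part_sum: "part P (sum f A) = (\<Sum>x\<in>A. part P (f x))"
  by (induction A rule: infinite_finite_induct) (auto simp: part_add)

lemma part_single: "part P (Poly_Mapping.single u c) = (if P u then Poly_Mapping.single u c else 0)"
  by (rule poly_mapping_eqI) (simp add: lookup_part lookup_single when_def)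

lemma part_id: "(\<And>u. u \<in> keys p \<Longrightarrow> P u) \<Longrightarrow> part P p = p"
  by (rule poly_mapping_eqI) (auto simp: lookup_part in_keys_iff)

lemma part_poly_ring: "p \<in> poly_ring n \<Longrightarrow> part P p \<in> poly_ring n"
  by (auto simp: poly_ring_def keys_part)

lemma part_mult:
  assumes "\<And>u v. u \<in> keys p \<Longrightarrow> P (u + v) = Q v"
  shows "part P (p * q) = p * part Q q"
proof -
  have *: "part P (Poly_Mapping.single u a * q) = Poly_Mapping.single u a * part Q q"
    if "u \<in> keys p" for u a
    by (subst (1 2) mpol_expand[of q])
      (auto simp: sum_distrib_left part_sum mult_single part_single assms[OF that] intro!: sum.cong)
  have "part P (p * q) = (\<Sum>u\<in>keys p. part P (Poly_Mapping.single u (lookup p u) * q))"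
    by (subst mpol_expand[of p]) (simp add: sum_distrib_right part_sum)
  also have "\<dots> = (\<Sum>u\<in>keys p. Poly_Mapping.single u (lookup p u) * part Q q)"
    by (intro sum.cong refl *)
  also have "\<dots> = p * part Q q"
    by (subst (3) mpol_expand[of p]) (simp add: sum_distrib_right)
  finally show ?thesis .
qed

lemma monom_add_eq_0 [simp]: "u + v = 0 \<longleftrightarrow> u = 0 \<and> v = 0" for u v :: monom
  by (simp add: poly_mapping_eq_iff fun_eq_iff lookup_add) blast

text \<open>Two monomials have product 1 only if both are 1. Hence the constant term is
  multiplicative and realizes the map from S to K used for the tensor product.\<close>

lemma lookup_mult_zero: "lookup (p * q) 0 = lookup p 0 * lookup q 0" for p q :: "'k::field mpol"
proof -
  have "lookup (p * q) 0 = (\<Sum>u\<in>keys p. \<Sum>v\<in>keys q. if u + v = 0 then lookup p u * lookup q v else 0)"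
    by (subst (1) mpol_expand[of p], subst (1) mpol_expand[of q])
      (simp add: sum_product lookup_sum mult_single lookup_single when_def)
  also have "\<dots> = (\<Sum>u\<in>keys p. if u = 0 then (\<Sum>v\<in>keys q. if v = 0 then lookup p u * lookup q v else 0) else 0)"
    by (intro sum.cong refl) (auto intro!: sum.neutral sum.cong)
  also have "\<dots> = lookup p 0 * lookup q 0"
    by (simp add: in_keys_iff)
  finally show ?thesis .
qed

lemma keys_mult_single:
  "keys (p * Poly_Mapping.single u 1) = (\<lambda>v. v + u) ` keys p" for p :: "'k::field mpol"
proof -
  have *: "lookup (p * Poly_Mapping.single u 1) w = (\<Sum>v\<in>keys p. if v + u = w then lookup p v else 0)" for w
    by (subst (1) mpol_expand[of p])
      (simp add: sum_distrib_right mult_single lookup_sum lookup_single when_def)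
  have "lookup (p * Poly_Mapping.single u 1) (v + u) = lookup p v" for v
    by (simp add: * in_keys_iff)
  moreover have "\<exists>v\<in>keys p. w = v + u" if "w \<in> keys (p * Poly_Mapping.single u 1)" for w
  proof (rule ccontr)
    assume "\<not> ?thesis"
    then have "lookup (p * Poly_Mapping.single u 1) w = 0"
      unfolding * by (intro sum.neutral) auto
    with that show False by (simp add: in_keys_iff)
  qed
  ultimately show ?thesis by (auto simp: in_keys_iff)
qed

section \<open>Graded matrices, complexes and lifting\<close>

type_synonym 'a mat = "nat \<Rightarrow> nat \<Rightarrow> 'a"

text \<open>Only the inner dimension is an argument. The outer ranges are enforced by
  \<open>mhom\<close>, so products need no truncation and associativity holds without side
  conditions.\<close>

definition mmul :: "nat \<Rightarrow> 'a::comm_ring_1 mat \<Rightarrow> 'a mat \<Rightarrow> 'a mat" where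
  "mmul s A B = (\<lambda>a c. \<Sum>b<s. A a b * B b c)"

definition vapp :: "nat \<Rightarrow> 'a::comm_ring_1 mat \<Rightarrow> (nat \<Rightarrow> 'a) \<Rightarrow> nat \<Rightarrow> 'a" where
  "vapp s A v = (\<lambda>a. \<Sum>b<s. A a b * v b)"

definition mid :: "nat \<Rightarrow> 'a::comm_ring_1 mat" where
  "mid r = (\<lambda>a b. if a = b \<and> a < r then 1 else 0)"

lemma mmul_assoc: "mmul t (mmul s A B) C = mmul s A (mmul t B C)"
proof (intro ext)
  fix a c
  show "mmul t (mmul s A B) C a c = mmul s A (mmul t B C) a c"
    by (simp add: mmul_def sum_distrib_left sum_distrib_right mult.assoc) (rule sum.swap)
qed

lemma mmul_diff_left: "mmul s (A - A') B = mmul s A B - mmul s A' B"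
  and mmul_diff_right: "mmul s A (B - B') = mmul s A B - mmul s A B'"
  and mmul_uminus_left: "mmul s (- A) B = - mmul s A B"
  and mmul_uminus_right: "mmul s A (- B) = - mmul s A B"
  and mmul_zero_left [simp]: "mmul s 0 B = 0"
  and mmul_zero_right [simp]: "mmul s A 0 = 0"
  by (simp_all add: mmul_def fun_eq_iff algebra_simps sum_negf sum_subtractf)

lemma vapp_vapp: "vapp s A (vapp t B v) = vapp t (mmul s A B) v"
proof (intro ext)
  fix a
  show "vapp s A (vapp t B v) a = vapp t (mmul s A B) v a"
    by (simp add: mmul_def vapp_def sum_distrib_left sum_distrib_right mult.assoc) (rule sum.swap)
qed

lemma vapp_add: "vapp s A (v + w) = vapp s A v + vapp s A w"
  and vapp_uminus: "vapp s A (- v) = - vapp s A v"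
  and vapp_add_left: "vapp s (A + B) v = vapp s A v + vapp s B v"
  and vapp_diff_left: "vapp s (A - B) v = vapp s A v - vapp s B v"
  and vapp_uminus_left: "vapp s (- A) v = - vapp s A v"
  and vapp_zero [simp]: "vapp s A 0 = 0"
  and vapp_zero_left [simp]: "vapp s 0 v = 0"
  by (simp_all add: vapp_def fun_eq_iff algebra_simps sum.distrib sum_subtractf sum_negf)

lemma vapp_scale: "vapp s A (\<lambda>b. c * v b) = (\<lambda>a. c * vapp s A v a)"
  by (simp add: vapp_def fun_eq_iff sum_distrib_left algebra_simps)

lemma vapp_column: "vapp s A (\<lambda>b. B b c) = (\<lambda>a. mmul s A B a c)"
  by (simp add: vapp_def mmul_def)

lemma sum_mid_left: "(\<Sum>b<r. mid r a b * f b) = (if a < r then f a else 0)"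
  by (cases "a < r") (simp_all add: mid_def if_distrib[of "\<lambda>x. x * _"] sum.delta' cong: if_cong)

lemma sum_mid_right: "(\<Sum>b<r. f b * mid r b a) = (if a < r then f a else 0)"
  by (cases "a < r") (auto simp: mid_def if_distrib[of "\<lambda>x. _ * x"] intro!: sum.neutral cong: if_cong conj_cong)

lemma vapp_mid: "(\<And>b. \<not> b < r \<Longrightarrow> v b = 0) \<Longrightarrow> vapp r (mid r) v = v"
  by (auto simp: vapp_def sum_mid_left)

text \<open>
  Degree-preserving matrices between graded free modules. They vanish outside their range, so that
  identities between them are plain equations of functions.
\<close>

definition mhom :: "nat \<Rightarrow> nat \<Rightarrow> (nat \<Rightarrow> nat) \<Rightarrow> nat \<Rightarrow> (nat \<Rightarrow> nat) \<Rightarrow> 'k::field mpol mat \<Rightarrow> bool" where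
  "mhom n r s t \<sigma> A \<longleftrightarrow>
     (\<forall>a<r. \<forall>b<t. A a b \<in> poly_ring n \<and> (\<forall>u\<in>keys (A a b). mdeg u + s a = \<sigma> b)) \<and>
     (\<forall>a b. \<not> (a < r \<and> b < t) \<longrightarrow> A a b = 0)"

lemma mhom_zero [simp]: "mhom n r s t \<sigma> 0"
  by (simp add: mhom_def)

lemma mhom_mid [simp]: "mhom n r s r s (mid r)"
  by (auto simp: mhom_def mid_def)

lemma mhom_poly_ring: "mhom n r s t \<sigma> A \<Longrightarrow> A a b \<in> poly_ring n"
  by (cases "a < r \<and> b < t") (auto simp: mhom_def)

lemma mhom_deg: "mhom n r s t \<sigma> A \<Longrightarrow> u \<in> keys (A a b) \<Longrightarrow> mdeg u + s a = \<sigma> b"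
  by (cases "a < r \<and> b < t") (auto simp: mhom_def)

lemma mhom_outside: "mhom n r s t \<sigma> A \<Longrightarrow> \<not> (a < r \<and> b < t) \<Longrightarrow> A a b = 0"
  by (auto simp: mhom_def)

lemma mhom_add:
  assumes "mhom n r s t \<sigma> A" "mhom n r s t \<sigma> B"
  shows "mhom n r s t \<sigma> (A + B)"
  using assms Poly_Mapping.keys_add[of "A a b" "B a b" for a b]
  by (fastforce simp: mhom_def intro: poly_ring_add)

lemma mhom_uminus: "mhom n r s t \<sigma> A \<Longrightarrow> mhom n r s t \<sigma> (- A)"
  by (auto simp: mhom_def intro: poly_ring_uminus)

lemma mhom_diff: "mhom n r s t \<sigma> A \<Longrightarrow> mhom n r s t \<sigma> B \<Longrightarrow> mhom n r s t \<sigma> (A - B)"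
  using mhom_add[of n r s t \<sigma> A "- B"] by (simp add: mhom_uminus)

lemma mhom_mmul:
  assumes A: "mhom n r s t \<sigma> A" and B: "mhom n t \<sigma> q \<tau> B"
  shows "mhom n r s q \<tau> (mmul t A B)"
  unfolding mhom_def
proof (intro conjI allI impI ballI)
  fix a c
  show "mmul t A B a c \<in> poly_ring n"
    unfolding mmul_def by (intro poly_ring_sum poly_ring_mult mhom_poly_ring[OF A] mhom_poly_ring[OF B])
  show "mmul t A B a c = 0" if "\<not> (a < r \<and> c < q)"
    using that mhom_outside[OF A] mhom_outside[OF B] by (auto simp: mmul_def intro!: sum.neutral)
  fix u assume "u \<in> keys (mmul t A B a c)"
  then obtain b where "u \<in> keys (A a b * B b c)"
    using keys_sum[of "\<lambda>b. A a b * B b c" "{..<t}"] by (auto simp: mmul_def)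
  then obtain v w where "u = v + w" "v \<in> keys (A a b)" "w \<in> keys (B b c)"
    using keys_mult by blast
  then show "mdeg u + s a = \<tau> c"
    using mhom_deg[OF A] mhom_deg[OF B] by (metis mdeg_add add.assoc add.commute)
qed

text \<open>Twisting source and target by the same degree leaves the matrix unchanged; in the cone
  the twist is by the degree of the new generator.\<close>

lemma mhom_shift: "mhom n r s t \<sigma> A \<Longrightarrow> mhom n r (\<lambda>a. s a + c) t (\<lambda>b. \<sigma> b + c) A"
  by (fastforce simp: mhom_def)

lemma mmul_mid_left: "mhom n r s t \<sigma> A \<Longrightarrow> mmul r (mid r) A = A"
  by (intro ext) (simp add: mmul_def sum_mid_left mhom_outside)

lemma mmul_mid_right: "mhom n r s t \<sigma> A \<Longrightarrow> mmul t A (mid t) = A"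
  by (intro ext) (simp add: mmul_def sum_mid_right mhom_outside)

lemma mhom_column: "mhom n r s t \<sigma> A \<Longrightarrow> (\<lambda>a. A a b) \<in> free_mod n r"
  using mhom_poly_ring[of n r s t \<sigma> A] mhom_outside[of n r s t \<sigma> A] by (auto simp: free_mod_def)

lemma vapp_free_mod:
  assumes "mhom n r s t \<sigma> A" "v \<in> free_mod n t"
  shows "vapp t A v \<in> free_mod n r"
  using assms mhom_outside[OF assms(1)] mhom_poly_ring[OF assms(1)]
  by (auto simp: free_mod_def vapp_def intro!: poly_ring_sum poly_ring_mult sum.neutral)

lemma free_mod_add: "v \<in> free_mod n r \<Longrightarrow> w \<in> free_mod n r \<Longrightarrow> v + w \<in> free_mod n r"
  by (auto simp: free_mod_def intro: poly_ring_add)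

lemma free_mod_uminus: "v \<in> free_mod n r \<Longrightarrow> - v \<in> free_mod n r"
  by (auto simp: free_mod_def intro: poly_ring_uminus)

lemma free_mod_diff: "v \<in> free_mod n r \<Longrightarrow> w \<in> free_mod n r \<Longrightarrow> v - w \<in> free_mod n r"
  by (auto simp: free_mod_def intro: poly_ring_minus)

text \<open>Preimages can be taken homogeneous: discard the components of the wrong degree.\<close>

lemma homogeneous_lift:
  assumes D: "mhom n r s r' s' D" and M: "mhom n r s t \<sigma> M"
    and im: "\<And>b. b < t \<Longrightarrow> \<exists>w\<in>free_mod n r'. vapp r' D w = (\<lambda>a. M a b)"
  obtains N where "mhom n r' s' t \<sigma> N" "mmul r' D N = M"
proof -
  from im obtain w where w: "\<And>b. b < t \<Longrightarrow> w b \<in> free_mod n r' \<and> vapp r' D (w b) = (\<lambda>a. M a b)"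
    by metis
  define N where "N = (\<lambda>a b. if a < r' \<and> b < t then part (\<lambda>u. mdeg u + s' a = \<sigma> b) (w b a) else 0)"
  show thesis
  proof
    show "mhom n r' s' t \<sigma> N"
      using w by (auto simp: mhom_def N_def keys_part free_mod_def intro!: part_poly_ring)
    show "mmul r' D N = M"
    proof (intro ext)
      fix a b
      show "mmul r' D N a b = M a b"
      proof (cases "b < t")
        case True
        \<comment> \<open>Every monomial of \<open>D a a'\<close> has degree
          \<open>s' a' - s a\<close>, so cutting \<open>w b a'\<close> down to one degree is the
          same as cutting the product down to the corresponding degree.\<close>
        have *: "D a a' * part (\<lambda>u. mdeg u + s' a' = \<sigma> b) (w b a') =
                 part (\<lambda>u. mdeg u + s a = \<sigma> b) (D a a' * w b a')" for a'
          by (rule part_mult[symmetric]) (auto simp: mdeg_add dest: mhom_deg[OF D])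
        have "mmul r' D N a b = part (\<lambda>u. mdeg u + s a = \<sigma> b) (vapp r' D (w b) a)"
          using True by (simp add: mmul_def N_def * part_sum vapp_def)
        also have "\<dots> = M a b"
          using w[OF True] by (auto intro!: part_id mhom_deg[OF M])
        finally show ?thesis .
      qed (simp add: mmul_def N_def mhom_outside[OF M])
    qed
  qed
qed

section \<open>Graded complexes, lifting of chain maps, and homotopies\<close>

definition gcomplex :: "nat \<Rightarrow> (nat \<Rightarrow> nat) \<Rightarrow> (nat \<Rightarrow> nat \<Rightarrow> nat) \<Rightarrow> (nat \<Rightarrow> 'k::field mpol mat) \<Rightarrow> bool" where
  "gcomplex n r s D \<longleftrightarrow>
     (\<forall>k. mhom n (r k) (s k) (r (Suc k)) (s (Suc k)) (D k)) \<and>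
     (\<forall>k. mmul (r (Suc k)) (D k) (D (Suc k)) = 0)"

text \<open>Exactness is asked at the places \<open>k + 1\<close> only. The homology at place 0 is
  left open; in an augmented resolution of I it is S/I.\<close>

definition gacyclic :: "nat \<Rightarrow> (nat \<Rightarrow> nat) \<Rightarrow> (nat \<Rightarrow> 'k::field mpol mat) \<Rightarrow> bool" where
  "gacyclic n r D \<longleftrightarrow>
     (\<forall>k. \<forall>v\<in>free_mod n (r (Suc k)). vapp (r (Suc k)) (D k) v = 0 \<longrightarrow>
        (\<exists>w\<in>free_mod n (r (Suc (Suc k))). vapp (r (Suc (Suc k))) (D (Suc k)) w = v))"

lemma gcomplex_mhom: "gcomplex n r s D \<Longrightarrow> mhom n (r k) (s k) (r (Suc k)) (s (Suc k)) (D k)"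
  and gcomplex_mmul: "gcomplex n r s D \<Longrightarrow> mmul (r (Suc k)) (D k) (D (Suc k)) = 0"
  by (auto simp: gcomplex_def)

lemma gacyclicE:
  assumes "gacyclic n r D" "v \<in> free_mod n (r (Suc k))" "vapp (r (Suc k)) (D k) v = 0"
  obtains w where "w \<in> free_mod n (r (Suc (Suc k)))" "vapp (r (Suc (Suc k))) (D (Suc k)) w = v"
  using assms by (auto simp: gacyclic_def)

lemma gacyclic_column:
  assumes "gacyclic n r D" "mhom n (r (Suc k)) s t \<sigma> M" "mmul (r (Suc k)) (D k) M = 0"
  shows "\<exists>w\<in>free_mod n (r (Suc (Suc k))). vapp (r (Suc (Suc k))) (D (Suc k)) w = (\<lambda>a. M a b)"
  using assms(1) mhom_column[OF assms(2), of b] assms(3)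
  by (auto simp: gacyclic_def vapp_column fun_eq_iff)

text \<open>The comparison theorem, for maps into \<open>D'\<close> from the complex
  \<open>D\<close> twisted by \<open>c\<close>. Maps out of a free module are chosen column by
  column, and \<open>homogeneous_lift\<close> makes each choice degree-preserving.\<close>

lemma chain_map_lift:
  assumes C: "gcomplex n r s D" and C': "gcomplex n r' s' D'" and ac: "gacyclic n r' D'"
    and A0: "mhom n (r' 0) (s' 0) (r 0) (\<lambda>b. s 0 b + c) A0"
    and im: "\<And>b. \<exists>w\<in>free_mod n (r' 1). vapp (r' 1) (D' 0) w = (\<lambda>a. mmul (r 0) A0 (D 0) a b)"
  obtains A where "A 0 = A0" "\<And>k. mhom n (r' k) (s' k) (r k) (\<lambda>b. s k b + c) (A k)"
    "\<And>k. mmul (r' (Suc k)) (D' k) (A (Suc k)) = mmul (r k) (A k) (D k)"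
proof -
  \<comment> \<open>The invariant records that the next lifting problem is solvable. At place 0 this
    is the hypothesis \<open>im\<close>; later it follows from exactness.\<close>
  define P where "P k A \<longleftrightarrow> mhom n (r' k) (s' k) (r k) (\<lambda>b. s k b + c) A \<and> (k = 0 \<longrightarrow> A = A0) \<and>
      (\<forall>b. \<exists>w\<in>free_mod n (r' (Suc k)). vapp (r' (Suc k)) (D' k) w = (\<lambda>a. mmul (r k) A (D k) a b))" for k A
  define Q where "Q k A A' \<longleftrightarrow> mmul (r' (Suc k)) (D' k) A' = mmul (r k) A (D k)" for k A A'
  have "\<exists>f. \<forall>k. P k (f k) \<and> Q k (f k) (f (Suc k))"
  proof (rule dependent_nat_choice)
    show "\<exists>A. P 0 A" using A0 im by (auto simp: P_def)
    fix A k assume "P k A"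
    then have A: "mhom n (r' k) (s' k) (r k) (\<lambda>b. s k b + c) A"
      and imA: "\<And>b. \<exists>w\<in>free_mod n (r' (Suc k)). vapp (r' (Suc k)) (D' k) w = (\<lambda>a. mmul (r k) A (D k) a b)"
      by (auto simp: P_def)
    have "mhom n (r' k) (s' k) (r (Suc k)) (\<lambda>b. s (Suc k) b + c) (mmul (r k) A (D k))"
      by (rule mhom_mmul[OF A mhom_shift[OF gcomplex_mhom[OF C]]])
    from homogeneous_lift[OF gcomplex_mhom[OF C'] this imA]
    obtain A' where A': "mhom n (r' (Suc k)) (s' (Suc k)) (r (Suc k)) (\<lambda>b. s (Suc k) b + c) A'"
      and eq: "mmul (r' (Suc k)) (D' k) A' = mmul (r k) A (D k)" by blast
    have "mmul (r' (Suc k)) (D' k) (mmul (r (Suc k)) A' (D (Suc k))) = 0"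
      by (simp add: mmul_assoc[symmetric] eq) (simp add: mmul_assoc gcomplex_mmul[OF C])
    then have "P (Suc k) A'"
      unfolding P_def using A' gacyclic_column[OF ac mhom_mmul[OF A' mhom_shift[OF gcomplex_mhom[OF C]]]]
      by blast
    then show "\<exists>A'. P (Suc k) A' \<and> Q k A A'" using eq by (auto simp: Q_def)
  qed
  then show thesis using that unfolding P_def Q_def by blast
qed

text \<open>A chain map that vanishes at place 0 is null-homotopic: what is missing at each place is
  a cycle of the acyclic target and can be lifted.\<close>

lemma null_homotopy:
  assumes C: "gcomplex n r s D" and C': "gcomplex n r' s' D'" and ac: "gacyclic n r' D'"
    and T: "\<And>k. mhom n (r' k) (s' k) (r k) (s k) (T k)"
    and TD: "\<And>k. mmul (r' (Suc k)) (D' k) (T (Suc k)) = mmul (r k) (T k) (D k)"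
    and T0: "T 0 = 0"
  obtains h where "h 0 = 0" "\<And>k. mhom n (r' (Suc k)) (s' (Suc k)) (r k) (s k) (h k)"
    "\<And>k. T (Suc k) = mmul (r' (Suc (Suc k))) (D' (Suc k)) (h (Suc k)) + mmul (r k) (h k) (D k)"
proof -
  \<comment> \<open>The last conjunct says exactly that \<open>T (Suc k) - h D\<close> is killed by
    \<open>D' k\<close>, hence liftable. It holds at place 0 because \<open>T 0\<close> and
    \<open>h 0\<close> vanish.\<close>
  define P where "P k h \<longleftrightarrow> mhom n (r' (Suc k)) (s' (Suc k)) (r k) (s k) h \<and> (k = 0 \<longrightarrow> h = 0) \<and>
      mmul (r k) (mmul (r' (Suc k)) (D' k) h) (D k) = mmul (r k) (T k) (D k)" for k h
  define Q where "Q k h h' \<longleftrightarrow>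
      T (Suc k) = mmul (r' (Suc (Suc k))) (D' (Suc k)) h' + mmul (r k) h (D k)" for k h h'
  have "\<exists>f. \<forall>k. P k (f k) \<and> Q k (f k) (f (Suc k))"
  proof (rule dependent_nat_choice)
    show "\<exists>h. P 0 h" by (auto simp: P_def T0)
    fix h k assume "P k h"
    then have h: "mhom n (r' (Suc k)) (s' (Suc k)) (r k) (s k) h"
      and eq: "mmul (r k) (mmul (r' (Suc k)) (D' k) h) (D k) = mmul (r k) (T k) (D k)"
      by (auto simp: P_def)
    let ?M = "T (Suc k) - mmul (r k) h (D k)"
    have M: "mhom n (r' (Suc k)) (s' (Suc k)) (r (Suc k)) (s (Suc k)) ?M"
      by (intro mhom_diff T mhom_mmul[OF h] gcomplex_mhom[OF C])
    have "mmul (r' (Suc k)) (D' k) ?M = 0"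
      by (simp add: mmul_diff_right TD eq[symmetric] mmul_assoc)
    from homogeneous_lift[OF gcomplex_mhom[OF C'] M gacyclic_column[OF ac M this]]
    obtain h' where h': "mhom n (r' (Suc (Suc k))) (s' (Suc (Suc k))) (r (Suc k)) (s (Suc k)) h'"
      and eq': "mmul (r' (Suc (Suc k))) (D' (Suc k)) h' = ?M" by blast
    have "P (Suc k) h'"
      using h' by (simp add: P_def eq' mmul_diff_left mmul_assoc gcomplex_mmul[OF C])
    then show "\<exists>h'. P (Suc k) h' \<and> Q k h h'" using eq' by (auto simp: Q_def)
  qed
  then show thesis using that unfolding P_def Q_def by blast
qed

text \<open>
  Resolutions are handled in augmented form: place \<open>0\<close> is \<open>S\<close> itself and \<open>D 0\<close> is the augmentation,
  so that the free module \<open>F_i\<close> sits in place \<open>i + 1\<close>.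
\<close>

definition aug_res :: "nat \<Rightarrow> 'k::field mpol set \<Rightarrow> (nat \<Rightarrow> nat) \<Rightarrow> (nat \<Rightarrow> nat \<Rightarrow> nat) \<Rightarrow>
    (nat \<Rightarrow> 'k mpol mat) \<Rightarrow> bool" where
  "aug_res n I r s D \<longleftrightarrow> r 0 = 1 \<and> s 0 0 = 0 \<and> gcomplex n r s D \<and> gacyclic n r D \<and>
     (\<lambda>v. vapp (r 1) (D 0) v 0) ` free_mod n (r 1) = I"

lemma aug_res_image:
  assumes "aug_res n I r s D" "p \<in> I"
  shows "\<exists>w\<in>free_mod n (r 1). vapp (r 1) (D 0) w = (\<lambda>a. if a = 0 then p else 0)"
proof -
  from assms obtain w where w: "w \<in> free_mod n (r 1)" "p = vapp (r 1) (D 0) w 0"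
    by (auto simp: aug_res_def)
  have "mhom n (r 0) (s 0) (r 1) (s 1) (D 0)" using gcomplex_mhom[of n r s D 0] assms by (simp add: aug_res_def)
  from vapp_free_mod[OF this w(1)] have "vapp (r 1) (D 0) w a = 0" if "a \<noteq> 0" for a
    using that assms by (auto simp: aug_res_def free_mod_def)
  with w show ?thesis by (intro bexI[of _ w]) (auto simp: fun_eq_iff)
qed

text \<open>Lifts multiplication by a monomial. The monomial 1 gives the independence of Tor from
  the resolution; a new generator \<open>u\<close> gives the map whose cone is taken.\<close>

lemma aug_res_comparison:
  assumes F: "aug_res n I r s D" and G: "aug_res n J r' s' D'" and u: "u \<in> monoms n"
    and sub: "\<And>p. p \<in> I \<Longrightarrow> xmon u * p \<in> J"
  obtains A where "\<And>k. mhom n (r' k) (s' k) (r k) (\<lambda>b. s k b + mdeg u) (A k)"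
    "\<And>k. mmul (r' (Suc k)) (D' k) (A (Suc k)) = mmul (r k) (A k) (D k)"
    "A 0 = (\<lambda>a b. if a = 0 \<and> b = 0 then xmon u else 0)"
proof -
  let ?A = "\<lambda>a b. if a = 0 \<and> b = 0 then xmon u else 0"
  have C: "gcomplex n r s D" "gcomplex n r' s' D'" "gacyclic n r' D'"
    and r: "r 0 = 1" "r' 0 = 1" "s 0 0 = 0" "s' 0 0 = 0" using F G by (auto simp: aug_res_def)
  have A0: "mhom n (r' 0) (s' 0) (r 0) (\<lambda>b. s 0 b + mdeg u) ?A"
    using u r by (auto simp: mhom_def xmon_def poly_ring_single split: if_splits)
  have im: "\<exists>w\<in>free_mod n (r' 1). vapp (r' 1) (D' 0) w = (\<lambda>a. mmul (r 0) ?A (D 0) a b)" for b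
  proof -
    \<comment> \<open>The b-th basis vector, or 0 when \<open>b\<close> is out of range: its image
      shows that column \<open>b\<close> of the augmentation lies in \<open>I\<close>.\<close>
    let ?w = "\<lambda>i. if i = b \<and> b < r 1 then 1 else 0"
    have "D 0 0 b = vapp (r 1) (D 0) ?w 0"
      using mhom_outside[OF gcomplex_mhom[OF C(1), of 0]]
      by (auto simp: vapp_def if_distrib[of "\<lambda>x. _ * x"] cong: if_cong conj_cong)
    moreover have "?w \<in> free_mod n (r 1)" by (auto simp: free_mod_def)
    ultimately have "D 0 0 b \<in> I" using F unfolding aug_res_def by blast
    from aug_res_image[OF G sub[OF this]] show ?thesis
      using r by (simp add: mmul_def if_distrib[of "\<lambda>x. x * _"] fun_eq_iff cong: if_cong)
  qed
  show thesis
    by (rule chain_map_lift[OF C A0 im]) (use that in blast)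
qed

section \<open>Independence of Tor from the resolution\<close>

lemma (in vector_space) finite_independentI:
  assumes "V \<subseteq> span W" "finite W" "B \<subseteq> V" "independent B"
  shows "finite B"
  using independent_span_bound[of W B] assms by blast

text \<open>A comparison of dim Z/B with dim Z'/B' without quotient spaces. A basis of
  \<open>B\<close> is extended to one of \<open>Z\<close>; the images of the added vectors stay
  independent modulo \<open>B'\<close>, since a relation among them pulls back to a relation modulo
  \<open>B\<close>. The ambient space may be infinite-dimensional, so \<open>W\<close> and
  \<open>W'\<close> supply finiteness.\<close>

lemma (in vector_space) homology_dim_le:
  assumes sub: "subspace Z" "subspace B" "B \<subseteq> Z" "subspace B'" "B' \<subseteq> Z'"
    and fin: "Z \<subseteq> span W" "finite W" "Z' \<subseteq> span W'" "finite W'"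
    and f: "module_hom scale scale f" and fZ: "f ` Z \<subseteq> Z'"
    and inj: "\<And>z. z \<in> Z \<Longrightarrow> f z \<in> B' \<Longrightarrow> z \<in> B"
  shows "dim Z - dim B \<le> dim Z' - dim B'"
proof -
  interpret f: module_hom scale scale f by (rule f)
  obtain bB where bB: "bB \<subseteq> B" "independent bB" "B \<subseteq> span bB" "card bB = dim B"
    using basis_exists by blast
  obtain bZ where bZ: "bB \<subseteq> bZ" "bZ \<subseteq> Z" "independent bZ" "Z \<subseteq> span bZ"
    using maximal_independent_subset_extend[of bB Z] bB sub by blast
  obtain bB' where bB': "bB' \<subseteq> B'" "independent bB'" "B' \<subseteq> span bB'" "card bB' = dim B'"
    using basis_exists by blast
  have spB: "span bB = B" "span bB' = B'"
    using bB bB' sub span_minimal by blast+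
  have finZ: "finite bZ" using finite_independentI fin bZ by blast
  have finB': "finite bB'" using finite_independentI[of Z' W' bB'] fin bB' sub by blast
  have dimZ: "dim Z = card bZ" using basis_card_eq_dim bZ by metis
  have main: "independent (f ` F \<union> bB') \<and> card (f ` F \<union> bB') = card F + card bB'"
    if "finite F" "F \<subseteq> bZ - bB" for F
    using that
  proof (induction F rule: finite_induct)
    case empty
    then show ?case using bB' by simp
  next
    case (insert x F)
    \<comment> \<open>Otherwise \<open>f x\<close> agrees with some \<open>f z\<close>,
      \<open>z\<close> in the span of \<open>F\<close>, up to an element of \<open>B'\<close>. Then
      \<open>x - z\<close> lies in \<open>B\<close>, and \<open>x\<close> depends on the other
      vectors of the basis \<open>bZ\<close>.\<close>
    have notin: "f x \<notin> span (f ` F \<union> bB')"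
    proof
      assume "f x \<in> span (f ` F \<union> bB')"
      then obtain y b where y: "y \<in> span (f ` F)" "b \<in> B'" "f x = y + b"
        unfolding span_Un spB by blast
      then obtain z where z: "z \<in> span F" "y = f z" unfolding f.span_image by blast
      have "x \<in> bZ" "x \<notin> bB" "F \<subseteq> bZ" using insert.prems by auto
      have "F \<subseteq> Z" using \<open>F \<subseteq> bZ\<close> bZ by blast
      then have "z \<in> Z" using z span_minimal sub(1) by blast
      then have "x - z \<in> Z" using \<open>x \<in> bZ\<close> bZ subspace_diff[OF sub(1)] by blast
      moreover have "f (x - z) \<in> B'" using y z by (simp add: f.diff)
      ultimately have "x - z \<in> span bB" using inj spB by blast
      then have "(x - z) + z \<in> span (bB \<union> F)"
        by (intro span_add) (use z span_mono[of bB "bB \<union> F"] span_mono[of F "bB \<union> F"] in auto)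
      then have "x \<in> span (bZ - {x})"
        using span_mono[of "bB \<union> F" "bZ - {x}"] \<open>x \<notin> bB\<close> \<open>F \<subseteq> bZ\<close> insert.hyps bZ by auto
      then show False using \<open>x \<in> bZ\<close> bZ(3) by (auto simp: dependent_def)
    qed
    then have "f x \<notin> f ` F \<union> bB'" by (metis span_base)
    then have "card (insert (f x) (f ` F \<union> bB')) = Suc (card (f ` F \<union> bB'))"
      using insert.hyps finB' by (intro card_insert_disjoint) auto
    moreover have "independent (insert (f x) (f ` F \<union> bB'))"
      using notin insert by (intro independent_insertI) auto
    ultimately show ?case
      using insert by (simp only: image_insert Un_insert_left card_insert_disjoint) simp
  qed
  have "card (bZ - bB) + card bB' \<le> dim Z'"
  proof -
    let ?A = "f ` (bZ - bB) \<union> bB'"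
    have "independent ?A" and c: "card ?A = card (bZ - bB) + card bB'"
      using main[of "bZ - bB"] finZ by auto
    obtain C where C: "C \<subseteq> Z'" "independent C" "Z' \<subseteq> span C" "card C = dim Z'"
      using basis_exists by blast
    have finC: "finite C" using finite_independentI fin C by blast
    have "?A \<subseteq> Z'" using bZ fZ bB' sub by blast
    then have "?A \<subseteq> span C" using C by blast
    from independent_span_bound[OF finC \<open>independent ?A\<close> this] show ?thesis using c C by simp
  qed
  moreover have "card (bZ - bB) = dim Z - dim B"
    using dimZ bB bZ finZ by (simp add: card_Diff_subset finite_subset)
  ultimately show ?thesis using bB' by simp
qed

section \<open>Reduction to the residue field and graded pieces\<close>

interpretation fvs: vector_space "\<lambda>c v b. c * v b :: 'k::field"
  by unfold_locales (auto simp: algebra_simps)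

text \<open>The matrix of the map obtained by tensoring with K, that is, reduction modulo
  (x_1,...,x_n).\<close>

definition cst :: "'k::field mpol mat \<Rightarrow> 'k mat" where
  "cst A = (\<lambda>a b. lookup (A a b) 0)"

lemma cst_mmul: "cst (mmul s A B) = mmul s (cst A) (cst B)"
  by (simp add: cst_def mmul_def lookup_sum lookup_mult_zero)

lemma cst_add: "cst (A + B) = cst A + cst B"
  by (simp add: cst_def lookup_add fun_eq_iff)

lemma cst_diff: "cst (A - B) = cst A - cst B"
  by (simp add: cst_def lookup_minus fun_eq_iff)

lemma cst_zero [simp]: "cst 0 = 0"
  by (simp add: cst_def fun_eq_iff)

lemma cst_mid [simp]: "cst (mid r) = mid r"
  by (simp add: cst_def mid_def fun_eq_iff)

definition graded_part :: "nat \<Rightarrow> (nat \<Rightarrow> nat) \<Rightarrow> nat \<Rightarrow> (nat \<Rightarrow> 'k::field) set" where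
  "graded_part r s j = {v. \<forall>b. v b \<noteq> 0 \<longrightarrow> b < r \<and> s b = j}"

lemma subspace_graded_part: "fvs.subspace (graded_part r s j)"
proof -
  have "x b \<noteq> 0 \<or> y b \<noteq> 0" if "x b + y b \<noteq> 0" for x y :: "nat \<Rightarrow> 'a" and b
    using that by auto
  then show ?thesis by (force simp: fvs.subspace_def graded_part_def)
qed

definition unit_vec :: "nat \<Rightarrow> nat \<Rightarrow> 'k::field" where
  "unit_vec i b = (if b = i then 1 else 0)"

lemma inj_unit_vec: "inj unit_vec"
  unfolding unit_vec_def by (rule injI) (metis zero_neq_one)

lemma graded_part_span: "(graded_part r s j :: (nat \<Rightarrow> 'k::field) set) = fvs.span (unit_vec ` {b. b < r \<and> s b = j})"
proof
  show "fvs.span (unit_vec ` {b. b < r \<and> s b = j}) \<subseteq> (graded_part r s j :: (nat \<Rightarrow> 'k) set)"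
    by (rule fvs.span_minimal[OF _ subspace_graded_part])
      (auto simp: unit_vec_def graded_part_def split: if_splits)
  show "(graded_part r s j :: (nat \<Rightarrow> 'k) set) \<subseteq> fvs.span (unit_vec ` {b. b < r \<and> s b = j})"
  proof
    fix v :: "nat \<Rightarrow> 'k" assume v: "v \<in> graded_part r s j"
    have "v = (\<Sum>i\<in>{b. b < r \<and> s b = j}. (\<lambda>b. v i * unit_vec i b))"
    proof
      fix b
      have "(\<Sum>i\<in>A. (\<lambda>b. v i * unit_vec i b)) b = (\<Sum>i\<in>A. v i * unit_vec i b)" for A
        by (induction A rule: infinite_finite_induct) auto
      then show "v b = (\<Sum>i\<in>{b. b < r \<and> s b = j}. (\<lambda>b. v i * unit_vec i b)) b"
        using v by (auto simp: unit_vec_def graded_part_def if_distrib[of "\<lambda>x. _ * x"] cong: if_cong)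
    qed
    also have "\<dots> \<in> fvs.span (unit_vec ` {b. b < r \<and> s b = j})"
      by (intro fvs.span_sum fvs.span_scale fvs.span_base) auto
    finally show "v \<in> fvs.span (unit_vec ` {b. b < r \<and> s b = j})" .
  qed
qed

lemma independent_unit_vec:
  assumes "finite A"
  shows "fvs.independent (unit_vec ` A :: (nat \<Rightarrow> 'k::field) set)"
  using assms
proof (induction A)
  case empty
  then show ?case by (simp add: fvs.independent_empty)
next
  case (insert x A)
  have "fvs.subspace {v :: nat \<Rightarrow> 'k. v x = 0}" by (auto simp: fvs.subspace_def)
  then have "fvs.span (unit_vec ` A) \<subseteq> {v :: nat \<Rightarrow> 'k. v x = 0}"
    using insert.hyps by (intro fvs.span_minimal) (auto simp: unit_vec_def)
  then have "(unit_vec x :: nat \<Rightarrow> 'k) \<notin> fvs.span (unit_vec ` A)" by (auto simp: unit_vec_def)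
  then show ?case using insert by (simp add: fvs.independent_insert)
qed

lemma dim_graded_part: "fdim (graded_part r s j :: (nat \<Rightarrow> 'k::field) set) = card {b. b < r \<and> s b = j}"
proof -
  let ?A = "{b. b < r \<and> s b = j}"
  have "fdim (graded_part r s j :: (nat \<Rightarrow> 'k) set) = card (unit_vec ` ?A :: (nat \<Rightarrow> 'k) set)"
    unfolding graded_part_span by (rule fvs.dim_span_eq_card_independent[OF independent_unit_vec]) simp
  also have "\<dots> = card ?A"
    by (intro card_image inj_on_subset[OF inj_unit_vec]) simp
  finally show ?thesis .
qed

lemma graded_part_finite: "\<exists>W. finite W \<and> graded_part r s j \<subseteq> fvs.span W"
proof (intro exI conjI)
  show "finite (unit_vec ` {b. b < r \<and> s b = j})" by simp
  show "graded_part r s j \<subseteq> fvs.span (unit_vec ` {b. b < r \<and> s b = j})"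
    unfolding graded_part_span by (rule order_refl)
qed

lemma module_hom_vapp: "module_hom (\<lambda>c v b. c * v b) (\<lambda>c v b. c * v b :: 'k::field) (vapp s A)"
proof
  show "vapp s A (v + w) = vapp s A v + vapp s A w" for v w by (rule vapp_add)
  show "vapp s A (\<lambda>b. c * v b) = (\<lambda>b. c * vapp s A v b)" for c v by (rule vapp_scale)
qed

text \<open>A nonzero constant term in entry \<open>(a, b)\<close> forces
  \<open>s a = \<sigma> b\<close> by homogeneity, so tensoring with K preserves degrees.\<close>

lemma vapp_graded_part:
  assumes A: "mhom n r s t \<sigma> A" and v: "v \<in> graded_part t \<sigma> j"
  shows "vapp t (cst A) v \<in> graded_part r s j"
  unfolding graded_part_def
proof (intro CollectI allI impI)
  fix a assume "vapp t (cst A) v a \<noteq> 0"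
  then obtain b where "cst A a b * v b \<noteq> 0"
    unfolding vapp_def by (rule sum.not_neutral_contains_not_neutral)
  then have "lookup (A a b) 0 \<noteq> 0" "v b \<noteq> 0" by (auto simp: cst_def)
  then have "0 \<in> keys (A a b)" "A a b \<noteq> 0" by (auto simp: in_keys_iff)
  then show "a < r \<and> s a = j"
    using mhom_deg[OF A, of 0 a b] mhom_outside[OF A, of a b] v \<open>v b \<noteq> 0\<close>
    by (auto simp: graded_part_def)
qed

text \<open>The module F_i sits in place \<open>i + 1\<close>, whence the \<open>Suc\<close>. The
  guard \<open>i \<noteq> 0\<close> drops the augmentation: Tor is computed from the complex that
  ends with F_0.\<close>

definition tcycles :: "(nat \<Rightarrow> nat) \<Rightarrow> (nat \<Rightarrow> nat \<Rightarrow> nat) \<Rightarrow> (nat \<Rightarrow> 'k::field mpol mat) \<Rightarrow> nat \<Rightarrow> nat \<Rightarrow> (nat \<Rightarrow> 'k) set" where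
  "tcycles r s D i j = {v \<in> graded_part (r (Suc i)) (s (Suc i)) j.
     i \<noteq> 0 \<longrightarrow> vapp (r (Suc i)) (cst (D i)) v = 0}"

definition tbounds :: "(nat \<Rightarrow> nat) \<Rightarrow> (nat \<Rightarrow> nat \<Rightarrow> nat) \<Rightarrow> (nat \<Rightarrow> 'k::field mpol mat) \<Rightarrow> nat \<Rightarrow> nat \<Rightarrow> (nat \<Rightarrow> 'k) set" where
  "tbounds r s D i j = vapp (r (Suc (Suc i))) (cst (D (Suc i))) ` graded_part (r (Suc (Suc i))) (s (Suc (Suc i))) j"

lemma subspace_tcycles: "fvs.subspace (tcycles r s D i j)"
  using subspace_graded_part[of "r (Suc i)" "s (Suc i)" j]
  by (auto simp: fvs.subspace_def tcycles_def vapp_add vapp_scale fun_eq_iff)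

lemma subspace_tbounds: "fvs.subspace (tbounds r s D i j)"
proof -
  interpret module_hom "\<lambda>c v b. c * v b" "\<lambda>c v b. c * v b :: 'a" "vapp t A" for t A
    by (rule module_hom_vapp)
  show ?thesis unfolding tbounds_def by (rule subspace_image[OF subspace_graded_part])
qed

lemma tbounds_subset:
  assumes "gcomplex n r s D"
  shows "tbounds r s D i j \<subseteq> tcycles r s D i j"
  using vapp_graded_part[OF gcomplex_mhom[OF assms]]
  by (auto simp: tbounds_def tcycles_def vapp_vapp cst_mmul[symmetric] gcomplex_mmul[OF assms])

text \<open>Lifts \<open>A\<close>, \<open>B\<close> of the identity of \<open>I\<close> in the two
  directions satisfy that \<open>B A - 1\<close> is null-homotopic. Hence \<open>A\<close> is
  injective on homology, which gives this inequality; exchanging the resolutions gives the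
  other.\<close>

lemma tor_dim_mono:
  fixes D D' :: "nat \<Rightarrow> 'k::field mpol mat"
  assumes F: "aug_res n I r s D" and G: "aug_res n I r' s' D'"
  shows "fdim (tcycles r s D i j) - fdim (tbounds r s D i j) \<le>
         fdim (tcycles r' s' D' i j) - fdim (tbounds r' s' D' i j)"
proof -
  have C: "gcomplex n r s D" "gcomplex n r' s' D'" "gacyclic n r D" "gacyclic n r' D'"
    and r0: "r 0 = 1" "r' 0 = 1" using F G by (auto simp: aug_res_def)
  have one: "xmon 0 = (1 :: 'k mpol)" by (simp add: xmon_def)
  have sub: "\<And>p. p \<in> I \<Longrightarrow> xmon 0 * p \<in> I" by (simp add: one)
  from aug_res_comparison[OF F G monoms_zero sub, unfolded one mdeg_zero add_0_right]
  obtain A where A: "\<And>k. mhom n (r' k) (s' k) (r k) (s k) (A k)"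
    "\<And>k. mmul (r' (Suc k)) (D' k) (A (Suc k)) = mmul (r k) (A k) (D k)"
    "A 0 = (\<lambda>a b. if a = 0 \<and> b = 0 then 1 else 0)"
    by blast
  from aug_res_comparison[OF G F monoms_zero sub, unfolded one mdeg_zero add_0_right]
  obtain B where B: "\<And>k. mhom n (r k) (s k) (r' k) (s' k) (B k)"
    "\<And>k. mmul (r (Suc k)) (D k) (B (Suc k)) = mmul (r' k) (B k) (D' k)"
    "B 0 = (\<lambda>a b. if a = 0 \<and> b = 0 then 1 else 0)"
    by blast
  define T where "T k = mmul (r' k) (B k) (A k) - mid (r k)" for k
  have T: "mhom n (r k) (s k) (r k) (s k) (T k)" for k
    unfolding T_def by (intro mhom_diff mhom_mmul[OF B(1) A(1)] mhom_mid)
  have TD: "mmul (r (Suc k)) (D k) (T (Suc k)) = mmul (r k) (T k) (D k)" for k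
    using mmul_mid_left[OF gcomplex_mhom[OF C(1)]] mmul_mid_right[OF gcomplex_mhom[OF C(1)]]
    by (simp add: T_def mmul_diff_left mmul_diff_right mmul_assoc[symmetric] B(2))
      (simp add: mmul_assoc A(2))
  have T0: "T 0 = 0"
    by (auto simp: T_def r0 A(3) B(3) mmul_def mid_def fun_eq_iff)
  obtain h where h: "h 0 = 0" "\<And>k. mhom n (r (Suc k)) (s (Suc k)) (r k) (s k) (h k)"
    "\<And>k. T (Suc k) = mmul (r (Suc (Suc k))) (D (Suc k)) (h (Suc k)) + mmul (r k) (h k) (D k)"
    using null_homotopy[OF C(1,1,3) T TD T0] by blast
  let ?f = "vapp (r (Suc i)) (cst (A (Suc i)))"
  let ?Z = "tcycles r s D i j" and ?B = "tbounds r s D i j"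
  let ?Z' = "tcycles r' s' D' i j" and ?B' = "tbounds r' s' D' i j"
  obtain W W' :: "(nat \<Rightarrow> 'k) set" where W: "finite W" "graded_part (r (Suc i)) (s (Suc i)) j \<subseteq> fvs.span W"
    "finite W'" "graded_part (r' (Suc i)) (s' (Suc i)) j \<subseteq> fvs.span W'"
    using graded_part_finite by metis
  show ?thesis
  proof (rule fvs.homology_dim_le)
    show "?B \<subseteq> ?Z" "?B' \<subseteq> ?Z'" using tbounds_subset C by blast+
    show "module_hom (\<lambda>c v b. c * v b) (\<lambda>c v b. c * v b) ?f" by (rule module_hom_vapp)
    show "?Z \<subseteq> fvs.span W" "?Z' \<subseteq> fvs.span W'" using W by (auto simp: tcycles_def)
    show "?f ` ?Z \<subseteq> ?Z'"
    proof safe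
      fix v assume v: "v \<in> ?Z"
      have "vapp (r' (Suc i)) (cst (D' i)) (?f v) = vapp (r i) (cst (A i)) (vapp (r (Suc i)) (cst (D i)) v)"
        by (simp add: vapp_vapp cst_mmul[symmetric] A(2))
      then show "?f v \<in> ?Z'"
        using v vapp_graded_part[OF A(1)] by (auto simp: tcycles_def)
    qed
    fix v assume v: "v \<in> ?Z" and fv: "?f v \<in> ?B'"
    then have vg: "v \<in> graded_part (r (Suc i)) (s (Suc i)) j" by (simp add: tcycles_def)
    from fv obtain w where w: "w \<in> graded_part (r' (Suc (Suc i))) (s' (Suc (Suc i))) j"
      "?f v = vapp (r' (Suc (Suc i))) (cst (D' (Suc i))) w" by (auto simp: tbounds_def)
    have "vapp (r' (Suc i)) (cst (B (Suc i))) (?f v) =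
        vapp (r (Suc (Suc i))) (cst (D (Suc i))) (vapp (r' (Suc (Suc i))) (cst (B (Suc (Suc i)))) w)"
      by (simp add: w(2)) (simp add: vapp_vapp cst_mmul[symmetric] B(2))
    then have 1: "vapp (r' (Suc i)) (cst (B (Suc i))) (?f v) \<in> ?B"
      using vapp_graded_part[OF B(1) w(1)] by (auto simp: tbounds_def)
    \<comment> \<open>For \<open>i = 0\<close> there is no cycle condition on \<open>v\<close>; the
      term vanishes there because \<open>h 0 = 0\<close>.\<close>
    have "vapp (r i) (cst (h i)) (vapp (r (Suc i)) (cst (D i)) v) = 0"
      using v h(1) by (cases "i = 0") (auto simp: tcycles_def)
    then have "vapp (r (Suc i)) (cst (T (Suc i))) v =
        vapp (r (Suc (Suc i))) (cst (D (Suc i))) (vapp (r (Suc i)) (cst (h (Suc i))) v)"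
      by (simp add: h(3) cst_add vapp_add_left vapp_vapp cst_mmul)
    then have 2: "vapp (r (Suc i)) (cst (T (Suc i))) v \<in> ?B"
      using vapp_graded_part[OF h(2) vg] by (auto simp: tbounds_def)
    have "vapp (r (Suc i)) (mid (r (Suc i))) v = v"
      using vg by (intro vapp_mid) (auto simp: graded_part_def)
    \<comment> \<open>\<open>v\<close> is \<open>B A v\<close> minus \<open>T v\<close>. The first
      is a boundary since \<open>A v\<close> is one, the second by the homotopy.\<close>
    then have "v = vapp (r' (Suc i)) (cst (B (Suc i))) (?f v) - vapp (r (Suc i)) (cst (T (Suc i))) v"
      by (simp add: T_def cst_diff vapp_diff_left vapp_vapp cst_mmul)
    then show "v \<in> ?B" using fvs.subspace_diff[OF subspace_tbounds 1 2] by simp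
  qed (use W subspace_tcycles subspace_tbounds in auto)
qed

section \<open>Passing between \<open>free_complex\<close> records and augmented resolutions\<close>

definition aug_rank :: "'k::field free_complex \<Rightarrow> nat \<Rightarrow> nat" where
  "aug_rank F k = (case k of 0 \<Rightarrow> 1 | Suc i \<Rightarrow> frank F i)"

definition aug_shift :: "'k::field free_complex \<Rightarrow> nat \<Rightarrow> nat \<Rightarrow> nat" where
  "aug_shift F k b = (case k of 0 \<Rightarrow> 0 | Suc i \<Rightarrow> shift F i b)"

text \<open>A record may hold arbitrary entries outside its ranks; they are replaced by 0 because
  \<open>mhom\<close> demands it.\<close>

definition aug_diff :: "'k::field free_complex \<Rightarrow> nat \<Rightarrow> 'k mpol mat" where
  "aug_diff F k a b = (if a < aug_rank F k \<and> b < aug_rank F (Suc k)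
     then case k of 0 \<Rightarrow> aug F b | Suc i \<Rightarrow> diff F i a b else 0)"

lemma aug_rank_simps [simp]: "aug_rank F 0 = 1" "aug_rank F (Suc i) = frank F i"
  and aug_shift_simps [simp]: "aug_shift F 0 b = 0" "aug_shift F (Suc i) b = shift F i b"
  by (simp_all add: aug_rank_def aug_shift_def)

lemma vapp_aug_diff_Suc: "vapp (frank F (Suc i)) (aug_diff F (Suc i)) v = diff_map F i v"
  by (rule ext) (simp add: vapp_def diff_map_def mat_app_def aug_diff_def)

lemma vapp_aug_diff_0: "vapp (frank F 0) (aug_diff F 0) v = (\<lambda>a. if a = 0 then aug_map F v else 0)"
  by (rule ext) (simp add: vapp_def aug_map_def aug_diff_def mult.commute)

lemma vapp_cst_aug_diff: "vapp (frank F (Suc i)) (cst (aug_diff F (Suc i))) v = tensor_diff F i v"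
  by (rule ext) (simp add: vapp_def tensor_diff_def mat_app_def aug_diff_def cst_def)

lemma tensor_part_eq: "tensor_part F i j = graded_part (frank F i) (shift F i) j"
  by (simp add: tensor_part_def graded_part_def)

lemma tor_dim_eq:
  "tor_dim F i j = fdim (tcycles (aug_rank F) (aug_shift F) (aug_diff F) i j) -
                   fdim (tbounds (aug_rank F) (aug_shift F) (aug_diff F) i j)"
proof -
  have sh: "aug_shift F (Suc i) = shift F i" for i by (simp add: fun_eq_iff)
  have "tensor_cycles F i j = tcycles (aug_rank F) (aug_shift F) (aug_diff F) i j"
    by (cases i) (simp_all add: tensor_cycles_def tcycles_def tensor_part_eq sh vapp_cst_aug_diff)
  moreover have "tensor_bounds F i j = tbounds (aug_rank F) (aug_shift F) (aug_diff F) i j"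
    by (simp add: tensor_bounds_def tbounds_def tensor_part_eq sh vapp_cst_aug_diff)
  ultimately show ?thesis by (simp add: tor_dim_def)
qed

lemma aug_res_of_resolution:
  assumes F: "graded_free_resolution n I F"
  shows "aug_res n I (aug_rank F) (aug_shift F) (aug_diff F)"
proof -
  let ?R = "aug_rank F" and ?D = "aug_diff F"
  have hom: "mhom n (?R k) (aug_shift F k) (?R (Suc k)) (aug_shift F (Suc k)) (?D k)" for k
    using F by (cases k) (auto simp: mhom_def graded_free_resolution_def aug_diff_def)
  have ker: "vapp (?R (Suc k)) (?D k) v = 0 \<longleftrightarrow>
      (\<exists>w\<in>free_mod n (?R (Suc (Suc k))). vapp (?R (Suc (Suc k))) (?D (Suc k)) w = v)"
    if "v \<in> free_mod n (?R (Suc k))" for k v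
  proof (cases k)
    case 0
    have "vapp (?R (Suc k)) (?D k) v = 0 \<longleftrightarrow> aug_map F v = 0"
      by (auto simp: 0 vapp_aug_diff_0 fun_eq_iff)
    also have "\<dots> \<longleftrightarrow> v \<in> diff_map F 0 ` free_mod n (frank F 1)"
      using F that unfolding graded_free_resolution_def 0 by auto
    finally show ?thesis by (auto simp: 0 vapp_aug_diff_Suc)
  next
    case (Suc i)
    have "diff_map F i v = 0 \<longleftrightarrow> v \<in> diff_map F (Suc i) ` free_mod n (frank F (Suc (Suc i)))"
      using F that unfolding graded_free_resolution_def Suc by (simp add: set_eq_iff) blast
    then show ?thesis by (auto simp: Suc vapp_aug_diff_Suc)
  qed
  have "mmul (?R (Suc k)) (?D k) (?D (Suc k)) = 0" for k
  proof (intro ext)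
    fix a c
    \<comment> \<open>The definition of a resolution gives the complex property only through kernel
      = image. Applied to basis vectors, it says that the columns of each differential are cycles,
      which is the matrix equation.\<close>
    let ?w = "\<lambda>i. if i = c \<and> c < ?R (Suc (Suc k)) then 1 else 0"
    have w: "?w \<in> free_mod n (?R (Suc (Suc k)))" by (auto simp: free_mod_def)
    have c: "vapp (?R (Suc (Suc k))) (?D (Suc k)) ?w = (\<lambda>a. ?D (Suc k) a c)"
      using mhom_outside[OF hom]
      by (auto simp: vapp_def fun_eq_iff if_distrib[of "\<lambda>x. _ * x"] cong: if_cong conj_cong)
    have "vapp (?R (Suc k)) (?D k) (\<lambda>a. ?D (Suc k) a c) = 0"
      using ker[OF mhom_column[OF hom]] w c by blast
    then show "mmul (?R (Suc k)) (?D k) (?D (Suc k)) a c = 0 a c"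
      by (simp add: vapp_column fun_eq_iff)
  qed
  moreover have "(\<lambda>v. vapp (?R 1) (?D 0) v 0) ` free_mod n (?R 1) = I"
    using F by (simp add: graded_free_resolution_def vapp_aug_diff_0)
  ultimately show ?thesis
    using hom ker by (auto simp: aug_res_def gcomplex_def gacyclic_def)
qed

text \<open>Guarantees that the choice in \<open>betti\<close> picks an actual resolution.\<close>

lemma resolution_of_aug_res:
  fixes D :: "nat \<Rightarrow> 'k::field mpol mat"
  assumes G: "aug_res n I r s D"
  shows "\<exists>F. graded_free_resolution n I F"
proof -
  define F where "F = \<lparr>frank = (\<lambda>i. r (Suc i)), shift = (\<lambda>i. s (Suc i)), diff = (\<lambda>i. D (Suc i)), aug = D 0 0\<rparr>"
  have C: "gcomplex n r s D" "gacyclic n r D" "r 0 = 1" "s 0 0 = 0" using G by (auto simp: aug_res_def)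
  note hom = gcomplex_mhom[OF C(1)]
  have Fs: "frank F i = r (Suc i)" "shift F i = s (Suc i)" "diff F i = D (Suc i)" "aug F = D 0 0" for i
    by (simp_all add: F_def)
  have dm: "diff_map F i = vapp (r (Suc (Suc i))) (D (Suc i))" for i
    using mhom_outside[OF hom[of "Suc i"]] by (auto simp: diff_map_def mat_app_def vapp_def Fs fun_eq_iff)
  have am: "aug_map F v = vapp (r 1) (D 0) v 0" for v
    by (simp add: aug_map_def vapp_def Fs mult.commute)
  have am0: "aug_map F v = 0 \<longleftrightarrow> vapp (r 1) (D 0) v = 0" for v
  proof -
    have "vapp (r 1) (D 0) v a = 0" if "a \<noteq> 0" for a
      using that mhom_outside[OF hom[of 0]] C(3) by (simp add: vapp_def)
    then show ?thesis by (auto simp: am fun_eq_iff) (metis gr0I)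
  qed
  have ker: "{v \<in> free_mod n (r (Suc k)). vapp (r (Suc k)) (D k) v = 0} =
      vapp (r (Suc (Suc k))) (D (Suc k)) ` free_mod n (r (Suc (Suc k)))" for k
    using C(2) vapp_free_mod[OF hom] by (auto simp: gacyclic_def vapp_vapp gcomplex_mmul[OF C(1)])
  have "graded_free_resolution n I F"
    unfolding graded_free_resolution_def
  proof (intro conjI allI impI ballI)
    show "aug_map F ` free_mod n (frank F 0) = I"
    proof -
      have "frank F 0 = r 1" by (simp add: Fs)
      moreover have "aug_map F = (\<lambda>v. vapp (r 1) (D 0) v 0)" by (rule ext) (rule am)
      ultimately show ?thesis using G by (simp only: aug_res_def)
    qed
    show "{v \<in> free_mod n (frank F 0). aug_map F v = 0} = diff_map F 0 ` free_mod n (frank F 1)"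
      using ker[of 0] by (simp add: am0 dm Fs)
    show "{v \<in> free_mod n (frank F (Suc i)). diff_map F i v = 0} =
        diff_map F (Suc i) ` free_mod n (frank F (Suc (Suc i)))" for i
      using ker[of "Suc i"] by (simp add: dm Fs)
    show "aug F b \<in> poly_ring n" for b using mhom_poly_ring[OF hom] by (simp add: Fs)
    show "diff F i a b \<in> poly_ring n" for i a b using mhom_poly_ring[OF hom] by (simp add: Fs)
    show "mdeg u = shift F 0 b" if "u \<in> keys (aug F b)" for u b
      using mhom_deg[OF hom[of 0], of u 0 b] that C by (simp add: Fs)
    show "mdeg u + shift F i a = shift F (Suc i) b" if "u \<in> keys (diff F i a b)" for u i a b
      using mhom_deg[OF hom, of u "Suc i" a b] that by (simp add: Fs)
  qed
  then show ?thesis by blast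
qed

text \<open>All differentials vanish after tensoring, so Tor is the tensored free module itself. Tor
  does not see the augmentation \<open>D 0\<close>, so minimality is asked from \<open>D 1\<close>
  on.\<close>

lemma betti_minimal:
  fixes D :: "nat \<Rightarrow> 'k::field mpol mat"
  assumes G: "aug_res n I r s D" and min: "\<And>k. cst (D (Suc k)) = 0"
  shows "betti n I i j = card {b. b < r (Suc i) \<and> s (Suc i) b = j}"
proof -
  define F where "F = (SOME F. graded_free_resolution n I F)"
  have "graded_free_resolution n I F"
    unfolding F_def using resolution_of_aug_res[OF G] by (rule someI_ex)
  note F = aug_res_of_resolution[OF this]
  have "tcycles r s D i j = graded_part (r (Suc i)) (s (Suc i)) j"
    using min by (cases i) (auto simp: tcycles_def)
  then have Z: "fdim (tcycles r s D i j) = card {b. b < r (Suc i) \<and> s (Suc i) b = j}"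
    by (simp only: dim_graded_part)
  have "tbounds r s D i j \<subseteq> fvs.span {}"
    using min by (auto simp: tbounds_def fvs.span_empty)
  from fvs.dim_le_card[OF this] have B: "fdim (tbounds r s D i j) = 0" by simp
  have "betti n I i j = tor_dim F i j" by (simp only: betti_def F_def)
  with tor_dim_mono[OF F G, of i j] tor_dim_mono[OF G F, of i j] show ?thesis
    unfolding tor_dim_eq Z B by linarith
qed

section \<open>Mapping cones\<close>

lemma sum_lessThan_add: "(\<Sum>b<q + q'. g b) = (\<Sum>b<q. g b) + (\<Sum>b<q'. g (b + q))" for q q' :: nat
  by (induction q') (simp_all add: ac_simps)

definition join :: "nat \<Rightarrow> (nat \<Rightarrow> 'a) \<Rightarrow> (nat \<Rightarrow> 'a) \<Rightarrow> nat \<Rightarrow> 'a" where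
  "join q f p = (\<lambda>b. if b < q then f b else p (b - q))"

text \<open>The block upper triangular matrix with rows (A B) and (0 C), where \<open>A\<close> has
  \<open>m\<close> rows and \<open>q\<close> columns.\<close>

definition block :: "nat \<Rightarrow> nat \<Rightarrow> 'a::zero mat \<Rightarrow> 'a mat \<Rightarrow> 'a mat \<Rightarrow> 'a mat" where
  "block m q A B C = (\<lambda>a b. if a < m then if b < q then A a b else B a (b - q)
     else if b < q then 0 else C (a - m) (b - q))"

lemma vapp_block:
  "vapp (q + q') (block m q A B C) (join q f p) = join m (vapp q A f + vapp q' B p) (vapp q' C p)"
  by (rule ext) (simp add: vapp_def join_def block_def sum_lessThan_add)

lemma mmul_block:
  "mmul (q + q') (block m q A B C) (block q x A' B' C') =
     block m x (mmul q A A') (mmul q A B' + mmul q' B C') (mmul q' C C')"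
  by (intro ext) (simp add: mmul_def block_def sum_lessThan_add)

lemma block_zero [simp]: "block m q 0 0 0 = 0"
  by (simp add: block_def fun_eq_iff)

lemma cst_block: "cst (block m q A B C) = block m q (cst A) (cst B) (cst C)"
  by (simp add: cst_def block_def fun_eq_iff)

lemma mhom_block:
  assumes A: "mhom n m s q \<sigma> A" and B: "mhom n m s q' \<sigma>' B" and C: "mhom n m' s' q' \<sigma>' C"
  shows "mhom n (m + m') (join m s s') (q + q') (join q \<sigma> \<sigma>') (block m q A B C)"
  unfolding mhom_def
proof (intro conjI allI impI ballI)
  fix a b
  show "block m q A B C a b \<in> poly_ring n"
    by (simp add: block_def mhom_poly_ring[OF A] mhom_poly_ring[OF B] mhom_poly_ring[OF C])
  show "mdeg u + join m s s' a = join q \<sigma> \<sigma>' b" if "u \<in> keys (block m q A B C a b)" for u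
    using that by (auto simp: block_def join_def mhom_deg[OF A] mhom_deg[OF B] mhom_deg[OF C] split: if_splits)
  show "block m q A B C a b = 0" if "\<not> (a < m + m' \<and> b < q + q')"
    using that mhom_outside[OF A, of a b] mhom_outside[OF B, of a "b - q"]
      mhom_outside[OF C, of "a - m" "b - q"]
    by (simp add: block_def) linarith
qed

lemma join_free_mod: "f \<in> free_mod n q \<Longrightarrow> p \<in> free_mod n q' \<Longrightarrow> join q f p \<in> free_mod n (q + q')"
  by (auto simp: free_mod_def join_def)

lemma free_mod_joinE:
  assumes "v \<in> free_mod n (q + q')"
  obtains f p where "f \<in> free_mod n q" "p \<in> free_mod n q'" "v = join q f p"
proof
  show "(\<lambda>b. if b < q then v b else 0) \<in> free_mod n q" "(\<lambda>b. v (b + q)) \<in> free_mod n q'"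
    using assms by (auto simp: free_mod_def)
  show "v = join q (\<lambda>b. if b < q then v b else 0) (\<lambda>b. v (b + q))"
    by (simp add: join_def fun_eq_iff)
qed

lemma join_eq_0:
  assumes "f \<in> free_mod n q" "join q f p = 0"
  shows "f = 0" "p = 0"
proof -
  have *: "join q f p b = 0" for b using assms(2) by simp
  show "f = 0"
  proof
    show "f b = 0 b" for b
      using *[of b] assms(1) by (cases "b < q") (auto simp: join_def free_mod_def)
  qed
  show "p = 0"
  proof
    show "p b = 0 b" for b using *[of "b + q"] by (simp add: join_def)
  qed
qed

lemma image_free_mod_add:
  "g ` free_mod n (q + q') = (\<lambda>(f, p). g (join q f p)) ` (free_mod n q \<times> free_mod n q')"
  by (auto intro: join_free_mod elim!: free_mod_joinE)

lemma aug_res_place_0: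
  assumes "aug_res n I r s D"
  shows "v \<in> free_mod n (r 0) \<longleftrightarrow> v 0 \<in> poly_ring n \<and> (\<forall>b. b \<noteq> 0 \<longrightarrow> v b = 0)"
  using assms by (auto simp: aug_res_def free_mod_def)

text \<open>
  The cone of the comparison map lifting \<open>u : Q(-deg u) \<rightarrow> I\<close>, where \<open>Q = I : u\<close>; it resolves
  \<open>I + (u)\<close> because of the exact sequence \<open>0 \<rightarrow> Q(-deg u) \<rightarrow> I \<oplus> S(-deg u) \<rightarrow> I + (u) \<rightarrow> 0\<close>.
\<close>

lemma cone_resolution:
  fixes D D' :: "nat \<Rightarrow> 'k::field mpol mat"
  assumes F: "aug_res n I r s D" and G: "aug_res n Q r' s' D'" and u: "u \<in> monoms n"
    and Q: "Q = {q \<in> poly_ring n. xmon u * q \<in> I}"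
  obtains r'' s'' D'' where
    "aug_res n {p + xmon u * q | p q. p \<in> I \<and> q \<in> poly_ring n} r'' s'' D''"
    "\<And>k. r'' (Suc k) = r (Suc k) + r' k"
    "\<And>k. s'' (Suc k) = join (r (Suc k)) (s (Suc k)) (\<lambda>b. s' k b + mdeg u)"
    "(\<forall>k. cst (D (Suc k)) = 0) \<and> (\<forall>k. cst (D' k) = 0) \<and>
     (\<forall>k. \<forall>a<r (Suc k). \<forall>b<r' (Suc k). s (Suc k) a \<noteq> s' (Suc k) b + mdeg u) \<longrightarrow>
     (\<forall>k. cst (D'' (Suc k)) = 0)"
proof -
  have C: "gcomplex n r s D" "gacyclic n r D" "r 0 = 1" "s 0 0 = 0"
    and C': "gcomplex n r' s' D'" "gacyclic n r' D'" "r' 0 = 1" "s' 0 0 = 0"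
    using F G by (auto simp: aug_res_def)
  note hom = gcomplex_mhom[OF C(1)] and hom' = gcomplex_mhom[OF C'(1)]
  obtain A where A: "\<And>k. mhom n (r k) (s k) (r' k) (\<lambda>b. s' k b + mdeg u) (A k)"
    and DA: "\<And>k. mmul (r (Suc k)) (D k) (A (Suc k)) = mmul (r' k) (A k) (D' k)"
    and A0: "A 0 = (\<lambda>a b. if a = 0 \<and> b = 0 then xmon u else 0)"
    by (rule aug_res_comparison[OF G F u]) (use Q in auto)
  \<comment> \<open>The complex of \<open>Q\<close> moves up one place as a whole: its copy of S at
    place 0 becomes the basis element mapped to \<open>u\<close>, and place 0 of the cone is S
    alone.\<close>
  define rr where "rr k = (case k of 0 \<Rightarrow> 0 | Suc j \<Rightarrow> r' j)" for k
  define ss where "ss k b = (case k of 0 \<Rightarrow> 0 | Suc j \<Rightarrow> s' j b + mdeg u)" for k b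
  \<comment> \<open>The sign makes the off-diagonal block \<open>D A - A D'\<close> of the squared
    differential vanish.\<close>
  define E where "E k = (case k of 0 \<Rightarrow> 0 | Suc j \<Rightarrow> - D' j)" for k
  have rr [simp]: "rr 0 = 0" "rr (Suc k) = r' k" for k by (simp_all add: rr_def)
  have ss [simp]: "ss (Suc k) = (\<lambda>b. s' k b + mdeg u)" for k by (simp add: ss_def fun_eq_iff)
  have E [simp]: "E 0 = 0" "E (Suc k) = - D' k" for k by (simp_all add: E_def)
  define r'' where "r'' k = r k + rr k" for k
  define s'' where "s'' k = join (r k) (s k) (ss k)" for k
  define D'' where "D'' k = block (r k) (r (Suc k)) (D k) (A k) (E k)" for k
  have homE: "mhom n (rr k) (ss k) (rr (Suc k)) (ss (Suc k)) (E k)" for k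
    using mhom_uminus[OF mhom_shift[OF hom']] by (cases k) auto
  have DD: "vapp (r'' (Suc k)) (D'' k) (join (r (Suc k)) f p) =
      join (r k) (vapp (r (Suc k)) (D k) f + vapp (r' k) (A k) p) (vapp (r' k) (E k) p)" for k f p
    by (simp add: r''_def D''_def vapp_block)
  have "gcomplex n r'' s'' D''"
    unfolding gcomplex_def
  proof (intro conjI allI)
    fix k
    show "mhom n (r'' k) (s'' k) (r'' (Suc k)) (s'' (Suc k)) (D'' k)"
      unfolding r''_def s''_def D''_def
      by (rule mhom_block[OF hom _ homE]) (simp add: A)
    have "mmul (r' k) (E k) (E (Suc k)) = 0"
      using gcomplex_mmul[OF C'(1)] by (cases k) (simp_all add: mmul_uminus_left mmul_uminus_right)
    then show "mmul (r'' (Suc k)) (D'' k) (D'' (Suc k)) = 0"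
      by (simp add: r''_def D''_def mmul_block gcomplex_mmul[OF C(1)] DA mmul_uminus_right)
  qed
  moreover have "gacyclic n r'' D''"
    unfolding gacyclic_def
  proof (intro allI ballI impI)
    fix k v assume "v \<in> free_mod n (r'' (Suc k))" and v0: "vapp (r'' (Suc k)) (D'' k) v = 0"
    then obtain f p where f: "f \<in> free_mod n (r (Suc k))" and p: "p \<in> free_mod n (r' k)"
      and v: "v = join (r (Suc k)) f p"
      by (auto simp: r''_def elim: free_mod_joinE)
    have "vapp (r (Suc k)) (D k) f + vapp (r' k) (A k) p \<in> free_mod n (r k)"
      by (intro free_mod_add vapp_free_mod[OF hom f] vapp_free_mod[OF A p])
    from join_eq_0[OF this] v0
    have fp: "vapp (r (Suc k)) (D k) f + vapp (r' k) (A k) p = 0" and Ep: "vapp (r' k) (E k) p = 0"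
      unfolding v DD by auto
    \<comment> \<open>At \<open>k = 0\<close> the relation \<open>fp\<close> says that
      \<open>u\<close> times the single entry of \<open>p\<close> lies in \<open>I\<close>, so this
      entry is in the colon ideal \<open>Q\<close> and is hit by its augmentation. At later places
      \<open>p\<close> is a cycle.\<close>
    have "\<exists>w\<in>free_mod n (r' (Suc k)). vapp (r' (Suc k)) (D' k) w = p"
    proof (cases k)
      case 0
      have "vapp (r 1) (D 0) (- f) 0 = xmon u * p 0"
        using fun_cong[OF fp, of 0] 0
        by (simp add: A0 vapp_def C'(3) sum_negf eq_neg_iff_add_eq_0 add.commute)
          (metis add.commute add_eq_0_iff)
      moreover have "vapp (r 1) (D 0) (- f) 0 \<in> I"
        using F f free_mod_uminus 0 by (fastforce simp: aug_res_def)
      ultimately have "p 0 \<in> Q" using aug_res_place_0[OF G] p 0 by (auto simp: Q)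
      moreover have "p = (\<lambda>a. if a = 0 then p 0 else 0)"
        using aug_res_place_0[OF G] p 0 by (auto simp: fun_eq_iff)
      ultimately show ?thesis using aug_res_image[OF G] 0 by fastforce
    next
      case (Suc j)
      then have "vapp (r' (Suc j)) (D' j) p = 0" using Ep by (simp add: vapp_uminus_left)
      then show ?thesis using C'(2) p Suc by (auto simp: gacyclic_def)
    qed
    then obtain w where w: "w \<in> free_mod n (r' (Suc k))" "vapp (r' (Suc k)) (D' k) w = p" by blast
    let ?p = "- w"
    have p': "?p \<in> free_mod n (r' (Suc k))" by (rule free_mod_uminus[OF w(1)])
    \<comment> \<open>Once \<open>p\<close> is a boundary, the same preimage corrects
      \<open>f\<close> through the comparison map; the corrected vector is a cycle of
      \<open>D\<close>.\<close>
    have "vapp (r (Suc k)) (D k) (f - vapp (r' (Suc k)) (A (Suc k)) ?p) =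
        vapp (r (Suc k)) (D k) f + vapp (r' k) (A k) (vapp (r' (Suc k)) (D' k) w)"
      by (simp add: vapp_add vapp_uminus vapp_vapp DA)
    then have "vapp (r (Suc k)) (D k) (f - vapp (r' (Suc k)) (A (Suc k)) ?p) = 0"
      by (simp add: w(2) fp)
    moreover have "f - vapp (r' (Suc k)) (A (Suc k)) ?p \<in> free_mod n (r (Suc k))"
      by (intro free_mod_diff f vapp_free_mod[OF A p'])
    ultimately obtain f' where f': "f' \<in> free_mod n (r (Suc (Suc k)))"
      "vapp (r (Suc (Suc k))) (D (Suc k)) f' = f - vapp (r' (Suc k)) (A (Suc k)) ?p"
      using gacyclicE[OF C(2)] by metis
    show "\<exists>w\<in>free_mod n (r'' (Suc (Suc k))). vapp (r'' (Suc (Suc k))) (D'' (Suc k)) w = v"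
    proof
      show "join (r (Suc (Suc k))) f' ?p \<in> free_mod n (r'' (Suc (Suc k)))"
        using join_free_mod[OF f'(1) p'] by (simp add: r''_def)
      show "vapp (r'' (Suc (Suc k))) (D'' (Suc k)) (join (r (Suc (Suc k))) f' ?p) = v"
        unfolding DD f'(2) by (simp add: vapp_uminus vapp_uminus_left w(2) v)
    qed
  qed
  moreover have "(\<lambda>v. vapp (r'' 1) (D'' 0) v 0) ` free_mod n (r'' 1) =
      {p + xmon u * q | p q. p \<in> I \<and> q \<in> poly_ring n}"
  proof -
    have *: "vapp (r'' 1) (D'' 0) (join (r 1) f p) 0 = vapp (r 1) (D 0) f 0 + xmon u * p 0" for f p
    proof -
      have "vapp (r' 0) (A 0) p 0 = xmon u * p 0" by (simp add: vapp_def A0 C'(3))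
      then show ?thesis using fun_cong[OF DD[of 0 f p], of 0] by (simp add: join_def[of "Suc 0"] C(3))
    qed
    have r1: "r'' 1 = r 1 + r' 0" by (simp add: r''_def)
    have I: "I = (\<lambda>v. vapp (r 1) (D 0) v 0) ` free_mod n (r 1)" using F by (simp add: aug_res_def)
    have P: "(\<lambda>b. if b = 0 then q else 0) \<in> free_mod n (r' 0)" if "q \<in> poly_ring n" for q
      using that by (simp add: aug_res_place_0[OF G])
    have "(\<lambda>v. vapp (r'' 1) (D'' 0) v 0) ` free_mod n (r'' 1) =
        (\<lambda>(f, p). vapp (r 1) (D 0) f 0 + xmon u * p 0) ` (free_mod n (r 1) \<times> free_mod n (r' 0))"
      unfolding r1 image_free_mod_add by (simp only: *[unfolded r1])
    also have "\<dots> = {p + xmon u * q | p q. p \<in> I \<and> q \<in> poly_ring n}"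
    proof (intro equalityI subsetI)
      fix x assume "x \<in> (\<lambda>(f, p). vapp (r 1) (D 0) f 0 + xmon u * p 0) ` (free_mod n (r 1) \<times> free_mod n (r' 0))"
      then obtain f p where f: "f \<in> free_mod n (r 1)" "p \<in> free_mod n (r' 0)"
        "x = vapp (r 1) (D 0) f 0 + xmon u * p 0" by auto
      then have "vapp (r 1) (D 0) f 0 \<in> I" "p 0 \<in> poly_ring n"
        using aug_res_place_0[OF G] by (auto simp: I)
      with f(3) show "x \<in> {p + xmon u * q | p q. p \<in> I \<and> q \<in> poly_ring n}" by blast
    next
      fix x assume "x \<in> {p + xmon u * q | p q. p \<in> I \<and> q \<in> poly_ring n}"
      then obtain f q where f: "f \<in> free_mod n (r 1)" "q \<in> poly_ring n"
        "x = vapp (r 1) (D 0) f 0 + xmon u * q" by (auto simp: I)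
      then have "x = (\<lambda>(f, p). vapp (r 1) (D 0) f 0 + xmon u * p 0) (f, \<lambda>b. if b = 0 then q else 0)"
        by simp
      then show "x \<in> (\<lambda>(f, p). vapp (r 1) (D 0) f 0 + xmon u * p 0) ` (free_mod n (r 1) \<times> free_mod n (r' 0))"
        by (rule image_eqI) (use f(1) P[OF f(2)] in simp)
    qed
    finally show ?thesis .
  qed
  ultimately have res: "aug_res n {p + xmon u * q | p q. p \<in> I \<and> q \<in> poly_ring n} r'' s'' D''"
    using C by (simp add: aug_res_def r''_def s''_def join_def)
  \<comment> \<open>The augmentation \<open>D' 0\<close> of \<open>Q\<close> becomes an ordinary
    differential of the cone, so it too must be free of constants. The comparison map has none
    because source and target degrees differ.\<close>
  have "cst (D'' (Suc k)) = 0"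
    if "cst (D (Suc k)) = 0" "cst (D' k) = 0"
      and deg: "\<And>a b. a < r (Suc k) \<Longrightarrow> b < r' (Suc k) \<Longrightarrow> s (Suc k) a \<noteq> s' (Suc k) b + mdeg u" for k
  proof -
    have "cst (A (Suc k)) = 0"
    proof (intro ext)
      fix a b
      show "cst (A (Suc k)) a b = 0 a b"
        using mhom_deg[OF A, of 0 "Suc k" a b] mhom_outside[OF A, of a "Suc k" b] deg[of a b]
        by (cases "a < r (Suc k) \<and> b < r' (Suc k)") (auto simp: cst_def in_keys_iff)
    qed
    moreover have "cst (- D' k) = 0" using that(2) by (simp add: cst_def fun_eq_iff)
    ultimately show ?thesis using that(1) by (simp add: D''_def cst_block)
  qed
  with that[OF res] show thesis by (simp add: r''_def s''_def)
qed

text \<open>Base case for both the Koszul complex and linear quotients: S in place 0 and nothing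
  else.\<close>

lemma aug_res_zero: "aug_res n {0 :: 'k::field mpol} (\<lambda>k. if k = 0 then 1 else 0) (\<lambda>k b. k) (\<lambda>k. 0)"
proof -
  have "free_mod n 0 = {0 :: nat \<Rightarrow> 'k mpol}" by (auto simp: free_mod_def fun_eq_iff)
  then show ?thesis by (auto simp: aug_res_def gcomplex_def gacyclic_def)
qed

section \<open>Monomial ideals with linear quotients\<close>

definition mdvd :: "monom \<Rightarrow> monom \<Rightarrow> bool" where
  "mdvd u v \<longleftrightarrow> (\<exists>w. v = u + w)"

lemma mdvd_iff: "mdvd u v \<longleftrightarrow> (\<forall>i. lookup u i \<le> lookup v i)"
proof
  assume "\<forall>i. lookup u i \<le> lookup v i"
  then have "v = u + (v - u)" by (intro poly_mapping_eqI) (simp add: lookup_add lookup_minus)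
  then show "mdvd u v" unfolding mdvd_def by blast
qed (auto simp: mdvd_def lookup_add)

lemma mdvd_refl [simp]: "mdvd u u"
  by (simp add: mdvd_iff)

lemma mdvd_trans: "mdvd u v \<Longrightarrow> mdvd v w \<Longrightarrow> mdvd u w"
  unfolding mdvd_iff using order_trans by blast

lemma mdvd_antisym: "mdvd u v \<Longrightarrow> mdvd v u \<Longrightarrow> u = v"
  by (intro poly_mapping_eqI order_antisym) (auto simp: mdvd_iff)

lemma mdvd_mdeg: "mdvd u v \<Longrightarrow> mdeg u \<le> mdeg v"
  by (auto simp: mdvd_def mdeg_add)

lemma mdvd_mdeg_eq: "mdvd u v \<Longrightarrow> mdeg u = mdeg v \<Longrightarrow> u = v"
  by (auto simp: mdvd_def mdeg_add)

definition var :: "nat \<Rightarrow> monom" where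
  "var k = Poly_Mapping.single k 1"

lemma keys_var [simp]: "keys (var k) = {k}"
  and mdeg_var [simp]: "mdeg (var k) = 1"
  and lookup_var: "lookup (var k) i = (if i = k then 1 else 0)"
  by (simp_all add: var_def lookup_single when_def)

lemma mdvd_var [simp]: "mdvd (var k) w \<longleftrightarrow> k \<in> keys w"
  by (auto simp: mdvd_iff lookup_var in_keys_iff Suc_le_eq)

lemma is_ideal_sum: "is_ideal n I \<Longrightarrow> (\<And>x. x \<in> A \<Longrightarrow> f x \<in> I) \<Longrightarrow> sum f A \<in> I"
  by (induction A rule: infinite_finite_induct) (auto simp: is_ideal_def)

text \<open>The right-hand side is an ideal containing the generators, and each of its elements is a
  sum of multiples of generators. This membership test, applied term by term, turns questions about
  ideals into questions of divisibility.\<close>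

lemma monom_ideal_eq:
  assumes "M \<subseteq> monoms n"
  shows "(monom_ideal n M :: 'k::field mpol set) = {p \<in> poly_ring n. \<forall>u\<in>keys p. \<exists>m\<in>M. mdvd m u}" (is "_ = ?J")
proof
  have "is_ideal n ?J"
    unfolding is_ideal_def
  proof (intro conjI ballI)
    show "p + q \<in> ?J" if "p \<in> ?J" "q \<in> ?J" for p q
      using that Poly_Mapping.keys_add[of p q] by (auto intro: poly_ring_add)
    show "s * p \<in> ?J" if "s \<in> poly_ring n" "p \<in> ?J" for s p
    proof -
      have "\<exists>m\<in>M. mdvd m u" if "u \<in> keys (s * p)" for u
      proof -
        from that obtain v w where "u = v + w" "w \<in> keys p" using keys_mult by blast
        moreover from this obtain m where "m \<in> M" "mdvd m w" using \<open>p \<in> ?J\<close> by blast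
        ultimately show ?thesis using mdvd_trans[of m w u] by (auto simp: mdvd_iff lookup_add)
      qed
      then show ?thesis using that by (auto intro: poly_ring_mult)
    qed
  qed auto
  moreover have "xmon ` M \<subseteq> ?J"
    using assms mdvd_refl by (fastforce simp: xmon_def intro!: poly_ring_single)
  ultimately show "monom_ideal n M \<subseteq> ?J"
    unfolding monom_ideal_def by (rule hull_minimal[rotated])
  show "?J \<subseteq> monom_ideal n M"
  proof
    fix p assume p: "p \<in> ?J"
    show "p \<in> monom_ideal n M"
      unfolding monom_ideal_def hull_def
    proof (intro InterI, safe)
      fix t :: "'k mpol set" assume t: "is_ideal n t" "xmon ` M \<subseteq> t"
      have "Poly_Mapping.single u (lookup p u) \<in> t" if "u \<in> keys p" for u
      proof -
        from that p obtain m w where m: "m \<in> M" "u = w + m"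
          by (auto simp: mdvd_def add.commute)
        have "u \<in> monoms n" using p that by (auto simp: poly_ring_def)
        then have "Poly_Mapping.single w (lookup p u) \<in> poly_ring n" "xmon m \<in> t"
          using t(2) m by (auto intro!: poly_ring_single)
        then have "Poly_Mapping.single w (lookup p u) * xmon m \<in> t"
          using t(1) unfolding is_ideal_def by blast
        then show ?thesis by (simp add: xmon_def mult_single m(2))
      qed
      then have "(\<Sum>u\<in>keys p. Poly_Mapping.single u (lookup p u)) \<in> t"
        by (intro is_ideal_sum[OF t(1)])
      then show "p \<in> t" using mpol_expand[of p] by simp
    qed
  qed
qed

lemma monom_ideal_xmon:
  "M \<subseteq> monoms n \<Longrightarrow> xmon u \<in> (monom_ideal n M :: 'k::field mpol set) \<longleftrightarrow>
     u \<in> monoms n \<and> (\<exists>m\<in>M. mdvd m u)"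
  by (auto simp: monom_ideal_eq xmon_def poly_ring_def)

text \<open>The ring \<open>poly_ring n\<close> is itself one of the ideals being intersected; this
  keeps the hull inside the ring.\<close>

lemma is_ideal_hull: "M \<subseteq> poly_ring n \<Longrightarrow> is_ideal n (is_ideal n hull M)"
proof -
  assume M: "M \<subseteq> poly_ring n"
  have "is_ideal n (poly_ring n :: 'a mpol set)"
    by (auto simp: is_ideal_def intro: poly_ring_add poly_ring_mult)
  with M have "is_ideal n hull M \<subseteq> poly_ring n" by (rule hull_minimal)
  then show ?thesis by (auto simp: is_ideal_def[of n "is_ideal n hull M"]) (auto simp: hull_def is_ideal_def)
qed

lemma is_ideal_monom_ideal: "M \<subseteq> monoms n \<Longrightarrow> is_ideal n (monom_ideal n M)"
  unfolding monom_ideal_def by (rule is_ideal_hull) (auto simp: xmon_def intro!: poly_ring_single)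

text \<open>Brings the enlarged ideal into the form that \<open>cone_resolution\<close>
  resolves.\<close>

lemma monom_ideal_insert:
  assumes M: "insert u M \<subseteq> monoms n"
  shows "(monom_ideal n (insert u M) :: 'k::field mpol set) =
     {p + xmon u * q | p q. p \<in> monom_ideal n M \<and> q \<in> poly_ring n}" (is "_ = ?J")
proof
  have I: "is_ideal n (monom_ideal n M :: 'k mpol set)" using M by (intro is_ideal_monom_ideal) auto
  have xu: "xmon u \<in> (poly_ring n :: 'k mpol set)" using M by (auto simp: xmon_def intro!: poly_ring_single)
  have "is_ideal n ?J"
    unfolding is_ideal_def
  proof (intro conjI ballI)
    show "?J \<subseteq> poly_ring n" using I xu by (auto simp: is_ideal_def intro!: poly_ring_add poly_ring_mult)
    show "0 \<in> ?J" using I by (auto simp: is_ideal_def intro!: exI[of _ 0])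
    show "x + y \<in> ?J" if "x \<in> ?J" "y \<in> ?J" for x y
    proof -
      from that obtain p q p' q' where *: "x = p + xmon u * q" "y = p' + xmon u * q'"
        "p \<in> monom_ideal n M" "p' \<in> monom_ideal n M" "q \<in> poly_ring n" "q' \<in> poly_ring n" by auto
      then have "x + y = (p + p') + xmon u * (q + q')" by (simp add: algebra_simps)
      then show ?thesis using * I unfolding is_ideal_def using poly_ring_add by blast
    qed
    show "s * x \<in> ?J" if "s \<in> poly_ring n" "x \<in> ?J" for s x
    proof -
      from that obtain p q where *: "x = p + xmon u * q" "p \<in> monom_ideal n M" "q \<in> poly_ring n" by auto
      then have "s * x = s * p + xmon u * (s * q)" by (simp add: algebra_simps)
      then show ?thesis using * I that(1) unfolding is_ideal_def using poly_ring_mult by blast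
    qed
  qed
  moreover have "xmon ` insert u M \<subseteq> ?J"
  proof -
    have "xmon m = xmon m + xmon u * (0 :: 'k mpol)" for m :: monom by simp
    moreover have "xmon u = (0 :: 'k mpol) + xmon u * 1" by simp
    moreover have "xmon m \<in> (monom_ideal n M :: 'k mpol set)" if "m \<in> M" for m
    proof -
      have M': "M \<subseteq> monoms n" using M by simp
      show ?thesis unfolding monom_ideal_xmon[OF M'] using M' that mdvd_refl by blast
    qed
    moreover have "0 \<in> (monom_ideal n M :: 'k mpol set)" using I by (simp add: is_ideal_def)
    ultimately show ?thesis using poly_ring_zero poly_ring_one by blast
  qed
  ultimately show "monom_ideal n (insert u M) \<subseteq> ?J"
    unfolding monom_ideal_def[of n "insert u M"] by (rule hull_minimal[rotated])
  have J: "is_ideal n (monom_ideal n (insert u M) :: 'k mpol set)" by (rule is_ideal_monom_ideal[OF M])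
  have sub: "(monom_ideal n M :: 'k mpol set) \<subseteq> monom_ideal n (insert u M)"
    unfolding monom_ideal_def by (intro hull_mono image_mono) auto
  have "xmon u \<in> (monom_ideal n (insert u M) :: 'k mpol set)"
    using M by (auto simp: monom_ideal_xmon)
  then show "?J \<subseteq> monom_ideal n (insert u M)"
    using J sub unfolding is_ideal_def by (auto simp: mult.commute[of "xmon u"])
qed

text \<open>Multiplication by a monomial only translates the support, so the colon ideal can be
  tested on monomials.\<close>

lemma colon_monom_ideal:
  assumes M: "M \<subseteq> monoms n" and u: "u \<in> monoms n" and L: "L \<subseteq> {1..n}"
    and colon: "\<And>w. w \<in> monoms n \<Longrightarrow> (\<exists>m\<in>M. mdvd m (w + u)) \<longleftrightarrow> (\<exists>k\<in>L. k \<in> keys w)"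
  shows "monom_ideal n (var ` L) =
     {q \<in> poly_ring n. xmon u * q \<in> (monom_ideal n M :: 'k::field mpol set)}"
proof -
  have L': "var ` L \<subseteq> monoms n" using L by (auto simp: monoms_def)
  have "xmon u * q \<in> poly_ring n" if "q \<in> poly_ring n" for q :: "'k mpol"
    using u that by (auto simp: xmon_def intro!: poly_ring_mult poly_ring_single)
  moreover have "(\<forall>w\<in>keys (xmon u * q). \<exists>m\<in>M. mdvd m w) \<longleftrightarrow> (\<forall>w\<in>keys q. \<exists>m\<in>var ` L. mdvd m w)"
    if "q \<in> poly_ring n" for q :: "'k mpol"
  proof -
    have "keys (xmon u * q) = (\<lambda>v. v + u) ` keys q"
      by (simp add: xmon_def keys_mult_single mult.commute[of "Poly_Mapping.single u 1"])
    moreover have "w \<in> monoms n" if "w \<in> keys q" for w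
      using \<open>q \<in> poly_ring n\<close> that by (auto simp: poly_ring_def)
    ultimately show ?thesis using colon by simp
  qed
  ultimately show ?thesis
    unfolding monom_ideal_eq[OF M] monom_ideal_eq[OF L'] by blast
qed

lemma monom_ideal_empty: "(monom_ideal n {} :: 'k::field mpol set) = {0}"
  by (auto simp: monom_ideal_eq)

text \<open>The Koszul complex, one variable at a time. A new variable \<open>x\<close> is a
  nonzerodivisor modulo the others, so the colon ideal is the old ideal and the cone joins the
  resolution with a twisted copy of itself; the ranks follow Pascal's rule.\<close>

lemma koszul_resolution:
  assumes "finite L" "L \<subseteq> {1..n}"
  shows "\<exists>r s D. aug_res n (monom_ideal n (var ` L) :: 'k::field mpol set) r s D \<and>
     (\<forall>k. r k = card L choose k) \<and> (\<forall>k. \<forall>b<r k. s k b = k)"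
  using assms
proof (induction L rule: finite_induct)
  case empty
  have "aug_res n (monom_ideal n (var ` {}) :: 'k mpol set)
      (\<lambda>k. if k = 0 then 1 else 0) (\<lambda>k b. k) (\<lambda>k. 0)"
    using aug_res_zero by (simp add: monom_ideal_empty)
  moreover have "(if k = 0 then 1 else 0) = card {} choose k" for k by (cases k) auto
  ultimately show ?case by blast
next
  case (insert x L)
  from insert obtain r s and D :: "nat \<Rightarrow> 'k mpol mat" where
    F: "aug_res n (monom_ideal n (var ` L)) r s D" and r: "\<And>k. r k = card L choose k"
    and s: "\<And>k b. b < r k \<Longrightarrow> s k b = k" by auto
  have x: "insert (var x) (var ` L) \<subseteq> monoms n" using insert.prems by (auto simp: monoms_def)
  have "(\<exists>m\<in>var ` L. mdvd m (w + var x)) \<longleftrightarrow> (\<exists>k\<in>L. k \<in> keys w)" for w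
    using insert.hyps by (auto simp: keys_add_nat)
  then have Q: "monom_ideal n (var ` L) = {q \<in> poly_ring n. xmon (var x) * q \<in> (monom_ideal n (var ` L) :: 'k mpol set)}"
    using x insert.prems by (intro colon_monom_ideal) auto
  have ux: "var x \<in> monoms n" using x by auto
  obtain r'' s'' and D'' :: "nat \<Rightarrow> 'k mpol mat" where
    C: "aug_res n {p + xmon (var x) * q | p q. p \<in> monom_ideal n (var ` L) \<and> q \<in> poly_ring n} r'' s'' D''"
      "\<And>k. r'' (Suc k) = r (Suc k) + r k"
      "\<And>k. s'' (Suc k) = join (r (Suc k)) (s (Suc k)) (\<lambda>b. s k b + mdeg (var x))"
    by (rule cone_resolution[OF F F ux Q]) blast
  have r0: "r'' 0 = 1" "s'' 0 0 = 0" using C(1) by (auto simp: aug_res_def)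
  have "r'' k = card (insert x L) choose k" for k
    using insert.hyps r0 by (cases k) (auto simp: C(2) r)
  moreover have "s'' k b = k" if "b < r'' k" for k b
    using that r0 s by (cases k) (auto simp: C(2,3) join_def)
  moreover have "aug_res n (monom_ideal n (var ` insert x L)) r'' s'' D''"
    unfolding image_insert monom_ideal_insert[OF x] by (rule C(1))
  ultimately show ?case by blast
qed

lemma card_join:
  "card {b. b < q + q' \<and> join q f g b = e} = card {b. b < q \<and> f b = e} + card {b. b < q' \<and> g b = e}"
proof -
  have "{b. b < q + q' \<and> join q f g b = e} = {b. b < q \<and> f b = e} \<union> (\<lambda>b. b + q) ` {b. b < q' \<and> g b = e}"
    (is "?A = ?B \<union> ?C")
  proof (intro equalityI subsetI)
    fix b assume b: "b \<in> ?A"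
    show "b \<in> ?B \<union> ?C"
    proof (cases "b < q")
      case False
      then have "b = (b - q) + q" "b - q \<in> {b. b < q' \<and> g b = e}" using b by (auto simp: join_def)
      then show ?thesis by blast
    qed (use b in \<open>simp add: join_def\<close>)
  qed (auto simp: join_def)
  then have "card ?A = card (?B \<union> ?C)" by (rule arg_cong)
  then show ?thesis
    by (subst (asm) card_Un_disjoint) (auto simp: card_image inj_on_def)
qed

text \<open>Each \<open>u\<close> contributes the Koszul complex on the variables in
  \<open>L u\<close>, twisted by its degree; this is the source of the binomials. The third claim,
  on the degrees that occur, carries the minimality through the induction.\<close>

lemma linear_quotients_resolution:
  fixes rank :: "monom \<Rightarrow> 'a::linorder"
  assumes "finite A" "A \<subseteq> monoms n" "inj_on rank A"
    and "\<And>u v. u \<in> A \<Longrightarrow> v \<in> A \<Longrightarrow> rank u \<le> rank v \<Longrightarrow> mdeg u \<le> mdeg v"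
    and "\<And>u. u \<in> A \<Longrightarrow> L u \<subseteq> {1..n}"
    and "\<And>u w. u \<in> A \<Longrightarrow> w \<in> monoms n \<Longrightarrow>
      (\<exists>v\<in>A. rank v < rank u \<and> mdvd v (w + u)) \<longleftrightarrow> (\<exists>k\<in>L u. k \<in> keys w)"
  shows "\<exists>r s D. aug_res n (monom_ideal n A :: 'k::field mpol set) r s D \<and> (\<forall>k. cst (D (Suc k)) = 0) \<and>
     (\<forall>k. \<forall>b<r (Suc k). \<exists>v\<in>A. s (Suc k) b = mdeg v + k) \<and>
     (\<forall>k e. card {b. b < r (Suc k) \<and> s (Suc k) b = e} = (\<Sum>u | u \<in> A \<and> mdeg u + k = e. card (L u) choose k))"
  using assms
proof (induction A rule: finite_ranking_induct[where f = rank])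
  case empty
  show ?case
    unfolding monom_ideal_empty by (intro exI conjI, rule aug_res_zero) (auto simp: cst_def)
next
  case (insert u S)
  note prem = insert.prems
  show ?case
  proof (cases "u \<in> S")
    case True
    then show ?thesis using insert by (simp add: insert_absorb)
  next
    case False
    \<comment> \<open>The new element has maximal rank, so it is not a predecessor of any element of
      \<open>S\<close>.\<close>
    have colonS: "(\<exists>v\<in>S. rank v < rank x \<and> mdvd v (w + x)) \<longleftrightarrow> (\<exists>k\<in>L x. k \<in> keys w)"
      if "x \<in> S" "w \<in> monoms n" for x w
      using prem(5)[of x w] insert.hyps(2)[of x] that by auto
    have "\<exists>r s D. aug_res n (monom_ideal n S :: 'k mpol set) r s D \<and> (\<forall>k. cst (D (Suc k)) = 0) \<and>
     (\<forall>k. \<forall>b<r (Suc k). \<exists>v\<in>S. s (Suc k) b = mdeg v + k) \<and>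
     (\<forall>k e. card {b. b < r (Suc k) \<and> s (Suc k) b = e} = (\<Sum>u | u \<in> S \<and> mdeg u + k = e. card (L u) choose k))"
      using prem colonS by (intro insert.IH) auto
    then obtain r s and D :: "nat \<Rightarrow> 'k mpol mat" where
      F: "aug_res n (monom_ideal n S) r s D" "\<And>k. cst (D (Suc k)) = 0"
        "\<And>k b. b < r (Suc k) \<Longrightarrow> \<exists>v\<in>S. s (Suc k) b = mdeg v + k"
        "\<And>k e. card {b. b < r (Suc k) \<and> s (Suc k) b = e} = (\<Sum>u | u \<in> S \<and> mdeg u + k = e. card (L u) choose k)"
      by blast
    have Lu: "L u \<subseteq> {1..n}" using prem(4) by simp
    obtain r' s' and D' :: "nat \<Rightarrow> 'k mpol mat" where
      G: "aug_res n (monom_ideal n (var ` L u)) r' s' D'"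
        "\<And>k. r' k = card (L u) choose k" "\<And>k b. b < r' k \<Longrightarrow> s' k b = k"
      using koszul_resolution[OF finite_subset[OF Lu] Lu] by blast
    have less: "rank v < rank u" if "v \<in> S" for v
      using insert.hyps(2)[OF that] prem(2) that False by (metis inj_onD insertCI order_le_less)
    have "(\<exists>m\<in>S. mdvd m (w + u)) \<longleftrightarrow> (\<exists>k\<in>L u. k \<in> keys w)" if "w \<in> monoms n" for w
      using prem(5)[of u w] that less by auto
    then have Q: "monom_ideal n (var ` L u) =
        {q \<in> poly_ring n. xmon u * q \<in> (monom_ideal n S :: 'k mpol set)}"
      using prem(1) Lu by (intro colon_monom_ideal) auto
    have u: "u \<in> monoms n" using prem(1) by simp
    obtain r'' s'' and D'' :: "nat \<Rightarrow> 'k mpol mat" where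
      C: "aug_res n {p + xmon u * q | p q. p \<in> monom_ideal n S \<and> q \<in> poly_ring n} r'' s'' D''"
        "\<And>k. r'' (Suc k) = r (Suc k) + r' k"
        "\<And>k. s'' (Suc k) = join (r (Suc k)) (s (Suc k)) (\<lambda>b. s' k b + mdeg u)"
      and min: "(\<forall>k. cst (D (Suc k)) = 0) \<and> (\<forall>k. cst (D' k) = 0) \<and>
        (\<forall>k. \<forall>a<r (Suc k). \<forall>b<r' (Suc k). s (Suc k) a \<noteq> s' (Suc k) b + mdeg u) \<longrightarrow>
        (\<forall>k. cst (D'' (Suc k)) = 0)"
      by (rule cone_resolution[OF F(1) G(1) u Q]) blast
    \<comment> \<open>Place \<open>k\<close> of the Koszul complex lives in degree \<open>k\<close>
      alone, so every entry has degree 1.\<close>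
    have "cst (D' k) = 0" for k
    proof (intro ext)
      fix a b
      have "mhom n (r' k) (s' k) (r' (Suc k)) (s' (Suc k)) (D' k)"
        using G(1) by (auto simp: aug_res_def gcomplex_def)
      note h = mhom_deg[OF this, of 0 a b] mhom_outside[OF this, of a b]
      show "cst (D' k) a b = 0 a b"
        using h G(3)[of a k] G(3)[of b "Suc k"]
        by (cases "a < r' k \<and> b < r' (Suc k)") (auto simp: cst_def in_keys_iff)
    qed
    \<comment> \<open>The degrees are at most \<open>mdeg u + k\<close> on the left and equal to
      \<open>mdeg u + k + 1\<close> on the right.\<close>
    moreover have "s (Suc k) a \<noteq> s' (Suc k) b + mdeg u" if ab: "a < r (Suc k)" "b < r' (Suc k)" for k a b
    proof -
      from F(3)[OF ab(1)] obtain v where v: "v \<in> S" "s (Suc k) a = mdeg v + k" by blast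
      then have "mdeg v \<le> mdeg u" using prem(3)[of v u] less[of v] by auto
      then show ?thesis using v G(3)[OF ab(2)] by simp
    qed
    ultimately have 1: "\<forall>k. cst (D'' (Suc k)) = 0" using min F(2) by blast
    have 2: "\<exists>v\<in>insert u S. s'' (Suc k) b = mdeg v + k" if "b < r'' (Suc k)" for k b
      using that F(3)[of b k] G(3)[of "b - r (Suc k)" k] by (auto simp: C(2,3) join_def)
    have 3: "card {b. b < r'' (Suc k) \<and> s'' (Suc k) b = e} =
        (\<Sum>v | v \<in> insert u S \<and> mdeg v + k = e. card (L v) choose k)" for k e
    proof -
      have "{b. b < r' k \<and> s' k b + mdeg u = e} = (if mdeg u + k = e then {..<r' k} else {})"
        using G(3) by (auto simp: add.commute)
      then have "card {b. b < r' k \<and> s' k b + mdeg u = e} = (if mdeg u + k = e then card (L u) choose k else 0)"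
        by (simp add: G(2))
      moreover have "{v. v \<in> insert u S \<and> mdeg v + k = e} =
          (if mdeg u + k = e then insert u {v. v \<in> S \<and> mdeg v + k = e} else {v. v \<in> S \<and> mdeg v + k = e})"
        by auto
      ultimately show ?thesis
        using insert.hyps(1) False by (simp add: C(2,3) card_join F(4))
    qed
    have "aug_res n (monom_ideal n (insert u S)) r'' s'' D''"
      unfolding monom_ideal_insert[OF prem(1)] by (rule C(1))
    with 1 2 3 show ?thesis by blast
  qed
qed

section \<open>Spread monomials\<close>

definition mon :: "nat list \<Rightarrow> monom" where
  "mon js = (\<Sum>j\<leftarrow>js. var j)"

lemma mon_simps [simp]: "mon [] = 0" "mon (j # js) = var j + mon js" "mon (js @ ks) = mon js + mon ks"
  by (simp_all add: mon_def)

lemma keys_mon [simp]: "keys (mon js) = set js"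
  by (induction js) (simp_all add: keys_add_nat)

lemma mdeg_mon [simp]: "mdeg (mon js) = length js"
  by (induction js) (simp_all add: mdeg_add)

lemma lookup_mon_eq_count: "lookup (mon js) i = count (mset js) i"
  by (induction js) (simp_all add: lookup_add lookup_var)

text \<open>A monomial is a multiset of indices, and a multiset has only one sorted
  enumeration.\<close>

lemma mon_sorted_inj: "sorted xs \<Longrightarrow> sorted ys \<Longrightarrow> mon xs = mon ys \<Longrightarrow> xs = ys"
proof -
  assume "sorted xs" "sorted ys" "mon xs = mon ys"
  then have "mset xs = mset ys" by (metis lookup_mon_eq_count multiset_eqI)
  then show "xs = ys"
    using \<open>sorted xs\<close> \<open>sorted ys\<close> by (metis sorted_list_of_multiset_mset sorted_sort_id)
qed

lemma mon_nth_split: "q < length js \<Longrightarrow> mon js = mon (take q js) + var (js ! q) + mon (drop (Suc q) js)"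
proof -
  assume "q < length js"
  then have "js = take q js @ js ! q # drop (Suc q) js" by (rule id_take_nth_drop)
  then have "mon js = mon (take q js @ js ! q # drop (Suc q) js)" by simp
  then show ?thesis by (simp add: add.assoc)
qed

text \<open>The right-hand side has the shape x_k (u / x_i) in which strong stability is
  stated.\<close>

lemma mon_update: "q < length js \<Longrightarrow> mon (js[q := k]) = var k + (mon js - var (js ! q))"
proof -
  assume q: "q < length js"
  have "mon js - var (js ! q) = mon (take q js) + mon (drop (Suc q) js)"
    by (rule poly_mapping_eqI) (simp add: mon_nth_split[OF q] lookup_minus lookup_add)
  then show ?thesis by (simp add: upd_conv_take_nth_drop[OF q] ac_simps)
qed

text \<open>Positions count from 0, so the gap after position \<open>r\<close> is governed by
  \<open>t (Suc r)\<close>.\<close>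

definition spread :: "(nat \<Rightarrow> nat) \<Rightarrow> nat list \<Rightarrow> bool" where
  "spread t js \<longleftrightarrow> (\<forall>r. Suc r < length js \<longrightarrow> js ! r + t (Suc r) \<le> js ! Suc r)"

lemma spreadD: "spread t js \<Longrightarrow> Suc r < length js \<Longrightarrow> js ! r + t (Suc r) \<le> js ! Suc r"
  by (simp add: spread_def)

lemma spread_sorted: "spread t js \<Longrightarrow> sorted js"
  unfolding sorted_iff_nth_Suc spread_def using le_trans[OF le_add1] by blast

lemma tspread_iff: "tspread d t u \<longleftrightarrow> (\<exists>js. spread t js \<and> length js \<le> d \<and> u = mon js)"
proof -
  have *: "(\<forall>r. 1 \<le> r \<and> r < length js \<longrightarrow> js ! (r - 1) + t r \<le> js ! r) \<longleftrightarrow> spread t js" for js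
  proof
    assume r: "\<forall>r. 1 \<le> r \<and> r < length js \<longrightarrow> js ! (r - 1) + t r \<le> js ! r"
    show "spread t js"
      unfolding spread_def
    proof (intro allI impI)
      show "js ! r + t (Suc r) \<le> js ! Suc r" if "Suc r < length js" for r
        using spec[OF r, of "Suc r"] that by simp
    qed
  next
    assume r: "spread t js"
    show "\<forall>r. 1 \<le> r \<and> r < length js \<longrightarrow> js ! (r - 1) + t r \<le> js ! r"
    proof (intro allI impI)
      show "js ! (r - 1) + t r \<le> js ! r" if "1 \<le> r \<and> r < length js" for r
        using spreadD[OF r, of "r - 1"] that by simp
    qed
  qed
  have "tspread d t u \<longleftrightarrow> (\<exists>js. sorted js \<and> length js \<le> d \<and> u = mon js \<and> spread t js)"
    by (simp only: tspread_def * flip: mon_def var_def)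
  then show ?thesis using spread_sorted by blast
qed

text \<open>Lowering an entry widens the gap on its right; only the gap on its left has to be
  checked.\<close>

lemma spread_update:
  assumes "spread t js" "q < length js" "k \<le> js ! q" "0 < q \<Longrightarrow> js ! (q - 1) + t q \<le> k"
  shows "spread t (js[q := k])"
  unfolding spread_def
proof (intro allI impI)
  fix r assume r: "Suc r < length (js[q := k])"
  then have *: "js ! r + t (Suc r) \<le> js ! Suc r" using assms(1) by (simp add: spread_def)
  show "js[q := k] ! r + t (Suc r) \<le> js[q := k] ! Suc r"
    using r * assms(2-4) by (auto simp: nth_list_update)
qed

text \<open>
  For \<open>js = [j_1, \<dots>, j_l]\<close> and \<open>m = l - 1\<close> this is \<open>{1, \<dots>, j_l - 1}\<close> without the intervals
  \<open>[j_r, j_r + t_r - 1]\<close>, \<open>r < l\<close>; as list positions start at \<open>0\<close>, \<open>js ! r\<close> is \<open>j_{r+1}\<close>.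
\<close>

definition vset :: "(nat \<Rightarrow> nat) \<Rightarrow> nat list \<Rightarrow> nat \<Rightarrow> nat set" where
  "vset t js m = {k. 1 \<le> k \<and> k < js ! m \<and> (\<forall>r<m. \<not> (js ! r \<le> k \<and> k < js ! r + t (Suc r)))}"

text \<open>Written as a sum so that no truncated subtraction can hide a deficit;
  \<open>1 \<le> js ! m\<close> makes the remaining one exact. Each step excludes the interval that
  starts at \<open>js ! m\<close> and adds the rest up to \<open>js ! Suc m\<close>.\<close>

lemma card_vset:
  assumes "spread t js" "m < length js" "1 \<le> js ! 0"
  shows "card (vset t js m) + (\<Sum>l=1..m. t l) = js ! m - 1 \<and> 1 \<le> js ! m"
  using assms(2)
proof (induction m)
  case 0
  have "vset t js 0 = {1..<js ! 0}" by (auto simp: vset_def)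
  then show ?case using assms(3) by simp
next
  case (Suc m)
  have le: "js ! m + t (Suc m) \<le> js ! Suc m" using spreadD[OF assms(1) Suc.prems] .
  \<comment> \<open>Earlier intervals end before \<open>js ! m\<close>, so the new block does not
    meet them.\<close>
  have mono: "js ! r + t (Suc r) \<le> js ! m" if "r < m" for r
    using spreadD[OF assms(1), of r] sorted_nth_mono[OF spread_sorted[OF assms(1)], of "Suc r" m] that Suc.prems
    by simp
  have "vset t js (Suc m) = vset t js m \<union> {js ! m + t (Suc m)..<js ! Suc m}"
  proof (intro equalityI subsetI)
    fix k assume "k \<in> vset t js (Suc m)"
    then show "k \<in> vset t js m \<union> {js ! m + t (Suc m)..<js ! Suc m}"
      by (auto simp: vset_def less_Suc_eq)
  next
    fix k assume "k \<in> vset t js m \<union> {js ! m + t (Suc m)..<js ! Suc m}"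
    then show "k \<in> vset t js (Suc m)"
    proof (elim UnE)
      assume "k \<in> vset t js m"
      then show ?thesis using le by (auto simp: vset_def less_Suc_eq)
    next
      assume k: "k \<in> {js ! m + t (Suc m)..<js ! Suc m}"
      have "js ! r + t (Suc r) \<le> k" if "r < m" for r
        using mono[OF that] k by simp
      then show ?thesis using k Suc by (fastforce simp: vset_def less_Suc_eq)
    qed
  qed
  moreover have "vset t js m \<inter> {js ! m + t (Suc m)..<js ! Suc m} = {}"
    by (auto simp: vset_def)
  moreover have "finite (vset t js m)" by (simp add: vset_def)
  ultimately have "card (vset t js (Suc m)) = card (vset t js m) + (js ! Suc m - (js ! m + t (Suc m)))"
    by (simp add: card_Un_disjoint)
  moreover have "card (vset t js m) + (\<Sum>l=1..m. t l) = js ! m - 1" "1 \<le> js ! m"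
    using Suc by auto
  moreover have "(\<Sum>l=1..Suc m. t l) = (\<Sum>l=1..m. t l) + t (Suc m)" by simp
  ultimately show ?case using le by linarith
qed

section \<open>First differences and the colon ideals\<close>

lemma sorted_not_in_drop:
  assumes "sorted xs" "q < length xs" "x < xs ! q"
  shows "x \<notin> set (drop (Suc q) xs)"
proof
  assume "x \<in> set (drop (Suc q) xs)"
  then obtain i where "i < length xs - Suc q" "x = xs ! (Suc q + i)"
    by (auto simp: in_set_conv_nth)
  moreover from this(1) have "Suc q + i < length xs" by linarith
  ultimately show False using sorted_nth_mono[OF assms(1), of q "Suc q + i"] assms(3) by simp
qed

lemma lex_first_difference:
  fixes xs ys :: "nat list"
  assumes "xs < ys" "length xs = length ys"
  obtains p where "p < length xs" "take p xs = take p ys" "xs ! p < ys ! p"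
  using assms by (auto simp: list_less_def lexord_take_index_conv)

lemma lex_lessI:
  fixes xs ys :: "nat list"
  assumes "p < length xs" "p < length ys" "take p xs = take p ys" "xs ! p < ys ! p"
  shows "xs < ys"
  using assms by (auto simp: list_less_def lexord_take_index_conv)

text \<open>
  If \<open>ks\<close> exceeds \<open>js\<close> at their first difference, replace that entry by the one of \<open>js\<close>: by strong
  stability the monomial stays in the ideal, and the first difference moves to the right.
\<close>

lemma colon_subset_vset:
  assumes stable: "\<And>ks q k. spread t ks \<Longrightarrow> length ks \<le> length js \<Longrightarrow> mon ks \<in> X \<Longrightarrow> q < length ks \<Longrightarrow>
      1 \<le> k \<Longrightarrow> k < ks ! q \<Longrightarrow> spread t (ks[q := k]) \<Longrightarrow> mon (ks[q := k]) \<in> X"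
    and X: "X \<subseteq> monoms n" and js: "spread t js" "set js \<subseteq> {1..n}" "js \<noteq> []"
    and min: "\<And>v. v \<in> X \<Longrightarrow> mdvd v (mon js) \<Longrightarrow> v = mon js"
    and "spread t ks" "mon ks \<in> X" "length ks \<le> length js" "mdvd (mon ks) (w + mon js)"
    and "q \<le> length ks" "take q ks = take q js" "length ks < length js \<or> length ks = length js \<and> ks < js"
  shows "\<exists>k\<in>vset t js (length js - 1). k \<in> keys w"
  using assms(7-)
proof (induction "length ks - q" arbitrary: ks q)
  case 0
  \<comment> \<open>No difference is left, so \<open>mon ks\<close> divides the minimal
    \<open>mon js\<close> and equals it. This contradicts \<open>ks\<close> being a proper
    predecessor.\<close>
  then have "ks = take q js" by simp
  then have js_eq: "mon js = mon ks + mon (drop q js)" by (metis append_take_drop_id mon_simps(3))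
  then have "mdvd (mon ks) (mon js)" unfolding mdvd_def by blast
  from min[OF 0(3) this] have "length ks = length js" by (metis mdeg_mon)
  then have "ks = js" using 0 by simp
  then show ?case using 0 by simp
next
  case (Suc x)
  note is_spread = Suc.prems(1) and isX = Suc.prems(2) and len = Suc.prems(3) and dvd = Suc.prems(4)
    and q = Suc.prems(5) and tk = Suc.prems(6) and lt = Suc.prems(7)
  have ql: "q < length ks" "q < length js" using Suc.hyps(2) len by auto
  have nth_eq: "ks ! r = js ! r" if "r < q" for r using tk that by (metis nth_take)
  note sj = sorted_nth_mono[OF spread_sorted[OF js(1)]] and si = sorted_nth_mono[OF spread_sorted[OF is_spread]]
  have dvd': "lookup (mon ks) i \<le> lookup w i + lookup (mon js) i" for i
    using dvd by (simp add: mdvd_iff lookup_add)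
  have "mon ks \<in> monoms n" using isX X by blast
  then have iss: "set ks \<subseteq> {1..n}" by (simp add: monoms_def)
  consider "ks ! q = js ! q" | "ks ! q < js ! q" | "js ! q < ks ! q" by linarith
  then show ?case
  proof cases
    case 1
    then have "take (Suc q) ks = take (Suc q) js" using ql tk by (simp add: take_Suc_conv_app_nth)
    then show ?thesis
      using Suc.hyps(1)[of ks "Suc q"] Suc.hyps(2) Suc.prems ql by auto
  next
    case 2
    \<comment> \<open>\<open>ks\<close> contains this index once more than \<open>js\<close> does:
      the prefixes agree, and \<open>js\<close> has only larger entries from position
      \<open>q\<close> on. The surplus must be paid for by \<open>w\<close>.\<close>
    let ?k = "ks ! q"
    have drop0: "lookup (mon (drop (Suc q) js)) ?k = 0"
    proof -
      have "?k \<notin> set (drop (Suc q) js)"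
        by (rule sorted_not_in_drop[OF spread_sorted[OF js(1)] ql(2) 2])
      then show ?thesis by (simp add: in_keys_iff flip: keys_mon)
    qed
    have "lookup (mon js) ?k = lookup (mon (take q js)) ?k"
      using 2 drop0 by (simp add: mon_nth_split[OF ql(2)] lookup_add lookup_var)
    moreover have "lookup (mon ks) ?k \<ge> lookup (mon (take q js)) ?k + 1"
      by (simp add: mon_nth_split[OF ql(1)] lookup_add lookup_var tk)
    ultimately have "?k \<in> keys w" using dvd'[of ?k] by (simp add: in_keys_iff)
    moreover have "?k \<in> vset t js (length js - 1)"
      unfolding vset_def
    proof (intro CollectI conjI allI impI notI)
      show "1 \<le> ?k" using iss ql(1) nth_mem by fastforce
      have "js ! q \<le> js ! (length js - 1)" using ql(2) by (intro sj) auto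
      then show "?k < js ! (length js - 1)" using 2 by simp
      fix r assume r: "r < length js - 1" and k: "js ! r \<le> ?k \<and> ?k < js ! r + t (Suc r)"
      \<comment> \<open>Intervals starting at position \<open>q\<close> or later begin above
        \<open>?k\<close>. Those before \<open>q\<close> start at entries shared with
        \<open>ks\<close>, whose own spreadness puts \<open>?k\<close> beyond them.\<close>
      have "r < q"
      proof (rule ccontr)
        assume "\<not> r < q"
        then have "js ! q \<le> js ! r" using r by (intro sj) auto
        then show False using k 2 by simp
      qed
      then have "js ! r + t (Suc r) \<le> ks ! Suc r"
        using spreadD[OF is_spread, of r] nth_eq[of r] ql by simp
      also have "\<dots> \<le> ?k" using \<open>r < q\<close> ql by (intro si) auto
      finally show False using k by simp
    qed
    ultimately show ?thesis by blast
  next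
    case 3
    \<comment> \<open>For equal lengths the lexicographic order makes \<open>ks\<close> smaller at
      the first difference. So an excess occurs only in smaller degree, where lowering entries
      preserves the precedence.\<close>
    have "length ks \<noteq> length js"
    proof
      assume eq: "length ks = length js"
      then have "ks < js" using lt by simp
      from lex_first_difference[OF this eq] obtain p where
        p: "p < length ks" "take p ks = take p js" "ks ! p < js ! p" by blast
      consider "p < q" | "p = q" | "q < p" by linarith
      then show False
        using nth_eq[of p] 3 p by cases (auto dest: arg_cong[where f = "\<lambda>xs. xs ! q"])
    qed
    then have less: "length ks < length js" using len by simp
    let ?ks = "ks[q := js ! q]"
    have sp: "spread t ?ks"
    proof (rule spread_update[OF is_spread ql(1)])
      show "js ! q \<le> ks ! q" using 3 by simp
      show "ks ! (q - 1) + t q \<le> js ! q" if "0 < q"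
        using spreadD[OF js(1), of "q - 1"] nth_eq[of "q - 1"] that ql by simp
    qed
    have "1 \<le> js ! q" using js(2) ql(2) nth_mem by fastforce
    then have "mon ?ks \<in> X" using 3 by (intro stable[OF is_spread len isX ql(1) _ _ sp]) auto
    moreover have "mdvd (mon ?ks) (w + mon js)"
      unfolding mdvd_iff lookup_add
    proof
      fix i
      show "lookup (mon ?ks) i \<le> lookup w i + lookup (mon js) i"
      proof (cases "i = js ! q")
        \<comment> \<open>\<open>js ! q\<close> does not occur in \<open>ks\<close> after position
          \<open>q\<close>, and the prefixes agree; so its exponent after the exchange is at most
          that in \<open>js\<close>.\<close>
        case True
        have "i \<notin> set (drop (Suc q) ks)"
          unfolding True by (rule sorted_not_in_drop[OF spread_sorted[OF is_spread] ql(1) 3])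
        then have "lookup (mon (drop (Suc q) ks)) i = 0" by (simp add: in_keys_iff flip: keys_mon)
        then have "lookup (mon ?ks) i \<le> lookup (mon js) i"
          using True ql tk by (simp add: upd_conv_take_nth_drop mon_nth_split[OF ql(2)] lookup_add lookup_var)
        then show ?thesis by simp
      next
        case False
        then have "lookup (mon ?ks) i \<le> lookup (mon ks) i"
          using ql by (simp add: mon_update lookup_add lookup_var lookup_minus)
        then show ?thesis using dvd'[of i] by simp
      qed
    qed
    moreover have "take (Suc q) ?ks = take (Suc q) js"
      using ql tk by (simp add: take_Suc_conv_app_nth)
    ultimately show ?thesis
      using Suc.hyps(1)[of ?ks "Suc q"] Suc.hyps(2) sp ql less by simp
  qed
qed

section \<open>Minimal generators and Betti numbers\<close>

text \<open>An antichain under divisibility is contained in every monomial generating set of its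
  ideal. This yields minimality and uniqueness at once, as the definite description
  requires.\<close>

lemma min_gens_monom_ideal:
  assumes G: "G \<subseteq> monoms n" and anti: "\<And>u v. u \<in> G \<Longrightarrow> v \<in> G \<Longrightarrow> mdvd v u \<Longrightarrow> v = u"
  shows "min_gens n (monom_ideal n G :: 'k::field mpol set) = G"
proof -
  let ?I = "monom_ideal n G :: 'k mpol set"
  have sub: "G \<subseteq> H" if H: "H \<subseteq> monoms n" "monom_ideal n H = ?I" for H
  proof
    fix u assume u: "u \<in> G"
    then have "xmon u \<in> ?I" using G mdvd_refl unfolding monom_ideal_xmon[OF G] by blast
    then obtain h where h: "h \<in> H" "mdvd h u"
      using H monom_ideal_xmon[OF H(1), of u, where 'k = 'k] by auto
    then have "xmon h \<in> ?I"
      using H mdvd_refl monom_ideal_xmon[OF H(1), of h, where 'k = 'k] by blast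
    then obtain g where "g \<in> G" "mdvd g h" unfolding monom_ideal_xmon[OF G] by blast
    then have "g = u" using anti u h mdvd_trans by blast
    then show "u \<in> H" using \<open>mdvd g h\<close> h mdvd_antisym by blast
  qed
  show ?thesis
    unfolding min_gens_def
  proof (rule the_equality)
    show "G \<subseteq> monoms n \<and> ?I = ?I \<and> (\<forall>H. H \<subset> G \<longrightarrow> monom_ideal n H \<noteq> ?I)"
      using G sub by blast
    fix H assume "H \<subseteq> monoms n \<and> monom_ideal n H = ?I \<and> (\<forall>H'. H' \<subset> H \<longrightarrow> monom_ideal n H' \<noteq> ?I)"
    then show "H = G" using sub[of H] by blast
  qed
qed

text \<open>Proper divisors have smaller degree, so descent terminates.\<close>

lemma minimal_monomial_below:
  assumes "u \<in> X"
  shows "\<exists>v\<in>X. mdvd v u \<and> (\<forall>w\<in>X. mdvd w v \<longrightarrow> w = v)"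
  using assms
proof (induction "mdeg u" arbitrary: u rule: less_induct)
  case less
  show ?case
  proof (cases "\<forall>w\<in>X. mdvd w u \<longrightarrow> w = u")
    case True
    then show ?thesis using less.prems mdvd_refl by blast
  next
    case False
    then obtain w where w: "w \<in> X" "mdvd w u" "w \<noteq> u" by blast
    then have "mdeg w < mdeg u" using mdvd_mdeg mdvd_mdeg_eq by (metis order_le_less)
    from less.hyps[OF this w(1)] show ?thesis using mdvd_trans w(2) by blast
  qed
qed

text \<open>The witness for G(I) is the set of divisibility-minimal monomials of the ideal.\<close>

lemma min_gens:
  fixes I :: "'k::field mpol set"
  assumes "is_monomial_ideal n I"
  shows "min_gens n I \<subseteq> monoms n" "monom_ideal n (min_gens n I) = I"
    "u \<in> min_gens n I \<Longrightarrow> v \<in> min_gens n I \<Longrightarrow> mdvd v u \<Longrightarrow> v = u"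
proof -
  obtain M where M: "M \<subseteq> monoms n" "I = monom_ideal n M"
    using assms by (auto simp: is_monomial_ideal_def)
  define X where "X = {u \<in> monoms n. \<exists>m\<in>M. mdvd m u}"
  define G where "G = {u \<in> X. \<forall>v\<in>X. mdvd v u \<longrightarrow> v = u}"
  have G: "G \<subseteq> monoms n" by (auto simp: G_def X_def)
  have "(\<exists>m\<in>G. mdvd m u) \<longleftrightarrow> (\<exists>m\<in>M. mdvd m u)" if "u \<in> monoms n" for u
  proof
    assume "\<exists>m\<in>G. mdvd m u"
    then show "\<exists>m\<in>M. mdvd m u" unfolding G_def X_def using mdvd_trans by blast
  next
    assume "\<exists>m\<in>M. mdvd m u"
    then have "u \<in> X" using that by (simp add: X_def)
    from minimal_monomial_below[OF this] show "\<exists>m\<in>G. mdvd m u" unfolding G_def by blast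
  qed
  then have "monom_ideal n G = I"
    unfolding M(2) monom_ideal_eq[OF G] monom_ideal_eq[OF M(1)]
    by (intro Collect_cong conj_cong refl ball_cong) (auto simp: poly_ring_def)
  moreover have anti: "\<And>u v. u \<in> G \<Longrightarrow> v \<in> G \<Longrightarrow> mdvd v u \<Longrightarrow> v = u" by (auto simp: G_def)
  ultimately have "min_gens n I = G" using min_gens_monom_ideal[OF G anti, where 'k = 'k] by simp
  with G anti \<open>monom_ideal n G = I\<close>
  show "min_gens n I \<subseteq> monoms n" "monom_ideal n (min_gens n I) = I"
    "u \<in> min_gens n I \<Longrightarrow> v \<in> min_gens n I \<Longrightarrow> mdvd v u \<Longrightarrow> v = u" by auto
qed

text \<open>Properness excludes the generator 1, which has no largest variable. The criterion
  mentions no field, so properness carries over to other coefficients.\<close>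

lemma monom_ideal_eq_ring_iff:
  assumes "G \<subseteq> monoms n"
  shows "(monom_ideal n G :: 'k::field mpol set) = poly_ring n \<longleftrightarrow> 0 \<in> G"
proof
  assume "(monom_ideal n G :: 'k mpol set) = poly_ring n"
  then have "(xmon 0 :: 'k mpol) \<in> monom_ideal n G" by (simp add: xmon_def)
  then show "0 \<in> G" by (auto simp: monom_ideal_xmon[OF assms] mdvd_def)
next
  assume "0 \<in> G"
  moreover have "mdvd 0 u" for u by (simp add: mdvd_iff)
  ultimately show "(monom_ideal n G :: 'k mpol set) = poly_ring n"
    unfolding monom_ideal_eq[OF assms] by blast
qed

text \<open>Indexed by the total degree \<open>e\<close>, so that \<open>e < i\<close>, where the
  sum is empty, is covered as well; the comparison of two fields ranges over all pairs of
  indices.\<close>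

lemma betti_tspread_strongly_stable:
  fixes I :: "'k::field mpol set"
  assumes stable: "tspread_strongly_stable n d t I" and proper: "I \<noteq> poly_ring n"
  shows "betti n I i e = (\<Sum>u | u \<in> min_gens n I \<and> mdeg u + i = e.
    (max_var u - 1 - (\<Sum>l=1..mdeg u - 1. t l)) choose i)"
proof -
  define G where "G = min_gens n I"
  define X where "X = {u. xmon u \<in> I}"
  have mono: "is_monomial_ideal n I" and Gsp: "\<And>u. u \<in> G \<Longrightarrow> tspread d t u"
    using stable by (auto simp: tspread_strongly_stable_def tspread_ideal_def G_def)
  have G: "G \<subseteq> monoms n" and I: "I = monom_ideal n G"
    and anti: "\<And>u v. u \<in> G \<Longrightarrow> v \<in> G \<Longrightarrow> mdvd v u \<Longrightarrow> v = u"
    using min_gens[OF mono] by (auto simp: G_def)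
  have X: "u \<in> X \<longleftrightarrow> u \<in> monoms n \<and> (\<exists>v\<in>G. mdvd v u)" for u
    unfolding X_def I using monom_ideal_xmon[OF G] by blast
  have "0 \<notin> G" using proper monom_ideal_eq_ring_iff[OF G, where 'k = 'k] I by simp
  define idx where "idx u = (SOME js. spread t js \<and> length js \<le> d \<and> u = mon js)" for u
  have idx: "spread t (idx u)" "length (idx u) \<le> d" "mon (idx u) = u" if "u \<in> G" for u
    using someI_ex[of "\<lambda>js. spread t js \<and> length js \<le> d \<and> u = mon js"] Gsp[OF that]
    by (auto simp: idx_def tspread_iff)
  have len: "length (idx u) = mdeg u" "set (idx u) = keys u" if "u \<in> G" for u
    using idx(3)[OF that] by (metis mdeg_mon, metis keys_mon)
  have keysG: "keys u \<subseteq> {1..n}" if "u \<in> G" for u using G that by (auto simp: monoms_def)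
  have ne: "idx u \<noteq> []" if "u \<in> G" for u
    using idx(3)[OF that] \<open>0 \<notin> G\<close> that by auto
  have "G \<subseteq> mon ` {js. set js \<subseteq> {1..n} \<and> length js \<le> d}"
  proof
    fix u assume u: "u \<in> G"
    then show "u \<in> mon ` {js. set js \<subseteq> {1..n} \<and> length js \<le> d}"
      using idx[OF u] keysG[OF u] len[OF u] by (intro image_eqI[of _ _ "idx u"]) auto
  qed
  then have finG: "finite G" by (rule finite_subset) (intro finite_imageI finite_lists_length_le finite_atLeastAtMost)
  have stableX: "mon (ks[q := k]) \<in> X"
    if "spread t ks" "length ks \<le> d" "mon ks \<in> X" "q < length ks" "1 \<le> k" "k < ks ! q" "spread t (ks[q := k])"
    for ks q k
  proof -
    have "ks ! q \<in> keys (mon ks)" using that by simp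
    moreover have "tspread d t (mon ks)" using that by (auto simp: tspread_iff)
    moreover have "tspread d t (var k + (mon ks - var (ks ! q)))"
      using that by (auto simp: tspread_iff mon_update[symmetric])
    ultimately show ?thesis
      using stable that unfolding tspread_strongly_stable_def X_def mon_update[OF that(4)] var_def by blast
  qed
  have minX: "v = u" if "u \<in> G" "v \<in> X" "mdvd v u" for u v
  proof -
    from that(2) obtain g where g: "g \<in> G" "mdvd g v" by (auto simp: X)
    then have "g = u" using anti that mdvd_trans by blast
    then show ?thesis using g that mdvd_antisym by blast
  qed
  \<comment> \<open>The degree is prepended to the index list, so the lexicographic order of lists
    compares degrees first.\<close>
  define rank where "rank u = mdeg u # idx u" for u
  define L where "L u = vset t (idx u) (length (idx u) - 1)" for u
  have rank_less: "rank v < rank u \<longleftrightarrow> mdeg v < mdeg u \<or> mdeg v = mdeg u \<and> idx v < idx u" for u v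
    by (auto simp: rank_def)
  have last: "idx u ! (length (idx u) - 1) = max_var u" if u: "u \<in> G" for u
  proof -
    have "Max (keys u) = idx u ! (length (idx u) - 1)"
    proof (rule Max_eqI)
      show "idx u ! (length (idx u) - 1) \<in> keys u"
        using ne[OF u] by (simp flip: len(2)[OF u])
      show "k \<le> idx u ! (length (idx u) - 1)" if "k \<in> keys u" for k
      proof -
        from that obtain r where r: "r < length (idx u)" "k = idx u ! r"
          by (auto simp: in_set_conv_nth simp flip: len(2)[OF u])
        then show ?thesis using sorted_nth_mono[OF spread_sorted[OF idx(1)[OF u]], of r "length (idx u) - 1"] by simp
      qed
    qed simp
    then show ?thesis by (simp add: max_var_def)
  qed
  \<comment> \<open>\<open>card_vset\<close> is an equation between sums, so the truncated
    subtractions in the formula lose nothing.\<close>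
  have cardL: "card (L u) = max_var u - 1 - (\<Sum>l=1..mdeg u - 1. t l)" if u: "u \<in> G" for u
  proof -
    have "idx u ! 0 \<in> keys u" using ne[OF u] by (simp flip: len(2)[OF u])
    then have "1 \<le> idx u ! 0" using keysG[OF u] by auto
    moreover have "length (idx u) - 1 < length (idx u)" using ne[OF u] by simp
    ultimately have "card (L u) + (\<Sum>l=1..length (idx u) - 1. t l) = max_var u - 1"
      using card_vset[OF idx(1)[OF u]] unfolding L_def last[OF u, symmetric] by blast
    then show ?thesis unfolding len(1)[OF u] by linarith
  qed
  have LG: "L u \<subseteq> {1..n}" if u: "u \<in> G" for u
  proof -
    have "max_var u \<in> keys u"
      using ne[OF u] last[OF u] by (metis len(2)[OF u] diff_less length_greater_0_conv nth_mem zero_less_one)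
    then have "max_var u \<le> n" using keysG[OF u] by auto
    then show ?thesis using last[OF u] by (auto simp: L_def vset_def)
  qed
  have colon: "(\<exists>v\<in>G. rank v < rank u \<and> mdvd v (w + u)) \<longleftrightarrow> (\<exists>k\<in>L u. k \<in> keys w)"
    if u: "u \<in> G" and w: "w \<in> monoms n" for u w
  proof
    assume "\<exists>v\<in>G. rank v < rank u \<and> mdvd v (w + u)"
    then obtain v where v: "v \<in> G" "rank v < rank u" "mdvd v (w + u)" by blast
    show "\<exists>k\<in>L u. k \<in> keys w"
      unfolding L_def
    proof (rule colon_subset_vset[where X = X and q = 0 and ks = "idx v"])
      show "mon (ks[q := k]) \<in> X"
        if "spread t ks" "length ks \<le> length (idx u)" "mon ks \<in> X" "q < length ks" "1 \<le> k" "k < ks ! q"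
          "spread t (ks[q := k])" for ks q k
        using stableX that idx(2)[OF u] by simp
      show "X \<subseteq> monoms n" using X by blast
      show "mon (idx v) \<in> X" using v(1) G X mdvd_refl by (auto simp: idx(3) intro: bexI[of _ v])
      show "set (idx u) \<subseteq> {1..n}" using keysG[OF u] len(2)[OF u] by simp
    qed (use v u rank_less[of v u] in \<open>auto simp: idx len ne minX\<close>)
  next
    assume "\<exists>k\<in>L u. k \<in> keys w"
    then obtain k where k: "k \<in> L u" "k \<in> keys w" by blast
    let ?js = "idx u"
    have ex: "k < ?js ! (length ?js - 1)" and k1: "1 \<le> k" using k by (auto simp: L_def vset_def)
    \<comment> \<open>The first index above \<open>k\<close>. Since \<open>k\<close> avoids the
      interval of the preceding index, it can take this place without violating the spread
      condition.\<close>
    define q where "q = (LEAST r. k < ?js ! r)"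
    have q: "k < ?js ! q" unfolding q_def by (rule LeastI[of _ "length ?js - 1"]) (rule ex)
    have "q \<le> length ?js - 1" unfolding q_def by (rule Least_le) (rule ex)
    then have ql: "q < length ?js" using ne[OF u] by (metis Suc_pred' le_imp_less_Suc length_greater_0_conv)
    have sp: "spread t (?js[q := k])"
    proof (rule spread_update[OF idx(1)[OF u] ql])
      show "k \<le> ?js ! q" using q by simp
      assume "0 < q"
      then have "\<not> k < ?js ! (q - 1)" unfolding q_def by (intro not_less_Least) simp
      moreover have "q - 1 < length ?js - 1"
        using \<open>0 < q\<close> \<open>q \<le> length ?js - 1\<close> by simp
      then have "\<not> (?js ! (q - 1) \<le> k \<and> k < ?js ! (q - 1) + t (Suc (q - 1)))"
        using k(1) unfolding L_def vset_def by blast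
      ultimately show "?js ! (q - 1) + t q \<le> k" using \<open>0 < q\<close> by auto
    qed
    have "mon ?js \<in> X" using u G X mdvd_refl by (auto simp: idx(3) intro: bexI[of _ u])
    then have "mon (?js[q := k]) \<in> X"
      using stableX idx u ql k1 q sp by blast
    \<comment> \<open>The exchanged monomial lies in \<open>I\<close> but need not be a generator. A
      generator dividing it has smaller degree than \<open>u\<close> or equals it, and then it is
      lexicographically smaller than \<open>u\<close>.\<close>
    then obtain v where v: "v \<in> G" "mdvd v (mon (?js[q := k]))" by (auto simp: X)
    have "mdeg v \<le> mdeg u" using mdvd_mdeg[OF v(2)] by (simp add: len(1)[OF u])
    have "rank v < rank u"
    proof (cases "mdeg v = mdeg u")
      case True
      then have "v = mon (?js[q := k])" using mdvd_mdeg_eq[OF v(2)] len(1)[OF u] by simp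
      then have "idx v = ?js[q := k]"
        using mon_sorted_inj[OF spread_sorted spread_sorted] idx v(1) sp by metis
      moreover have "?js[q := k] < ?js" by (rule lex_lessI[of q]) (use ql q in simp_all)
      ultimately show ?thesis using True by (simp add: rank_less)
    qed (use \<open>mdeg v \<le> mdeg u\<close> in \<open>simp add: rank_less\<close>)
    moreover have "mdvd v (w + u)"
    proof (rule mdvd_trans[OF v(2)])
      have "lookup (var k) i \<le> lookup w i" for i using k(2) by (auto simp: lookup_var in_keys_iff Suc_le_eq)
      then show "mdvd (mon (?js[q := k])) (w + u)"
        unfolding mdvd_iff mon_update[OF ql] idx(3)[OF u] lookup_add lookup_minus
        by (intro allI add_mono) auto
    qed
    ultimately show "\<exists>v\<in>G. rank v < rank u \<and> mdvd v (w + u)" using v(1) by blast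
  qed
  have "inj_on rank G"
  proof (rule inj_onI)
    fix u v assume uv: "u \<in> G" "v \<in> G" "rank u = rank v"
    then have "mon (idx u) = mon (idx v)" by (simp add: rank_def)
    then show "u = v" using uv by (simp only: idx(3))
  qed
  moreover have "mdeg u \<le> mdeg v" if "rank u \<le> rank v" for u v
    using that by (auto simp: rank_def)
  ultimately have "\<exists>r s D. aug_res n (monom_ideal n G :: 'k mpol set) r s D \<and> (\<forall>k. cst (D (Suc k)) = 0) \<and>
     (\<forall>k. \<forall>b<r (Suc k). \<exists>v\<in>G. s (Suc k) b = mdeg v + k) \<and>
     (\<forall>k e. card {b. b < r (Suc k) \<and> s (Suc k) b = e} = (\<Sum>u | u \<in> G \<and> mdeg u + k = e. card (L u) choose k))"
    using finG G LG colon by (intro linear_quotients_resolution[where rank = rank])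
  then obtain r s and D :: "nat \<Rightarrow> 'k mpol mat" where
    res: "aug_res n I r s D" "\<And>k. cst (D (Suc k)) = 0"
      "card {b. b < r (Suc i) \<and> s (Suc i) b = e} = (\<Sum>u | u \<in> G \<and> mdeg u + i = e. card (L u) choose i)"
    unfolding I by blast
  have "betti n I i e = (\<Sum>u | u \<in> G \<and> mdeg u + i = e. card (L u) choose i)"
    using betti_minimal[OF res(1,2)] res(3) by simp
  also have "\<dots> = (\<Sum>u | u \<in> G \<and> mdeg u + i = e. (max_var u - 1 - (\<Sum>l=1..mdeg u - 1. t l)) choose i)"
    by (rule sum.cong) (simp_all add: cardL)
  finally show ?thesis by (simp only: G_def)
qed

text \<open>Which monomials lie in a monomial ideal is decided by divisibility, so stability and
  minimal generators survive a change of field.\<close>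

lemma tspread_strongly_stable_monom_ideal:
  fixes I :: "'k::field mpol set"
  assumes "tspread_strongly_stable n d t I"
  shows "tspread_strongly_stable n d t (monom_ideal n (min_gens n I) :: 'l::field mpol set)"
    and "min_gens n (monom_ideal n (min_gens n I) :: 'l mpol set) = min_gens n I"
proof -
  let ?G = "min_gens n I"
  have mono: "is_monomial_ideal n I"
    using assms by (auto simp: tspread_strongly_stable_def tspread_ideal_def)
  note G = min_gens[OF mono]
  show eq: "min_gens n (monom_ideal n ?G :: 'l mpol set) = ?G"
    by (rule min_gens_monom_ideal[OF G(1,3)])
  have "xmon u \<in> (monom_ideal n ?G :: 'l mpol set) \<longleftrightarrow> xmon u \<in> I" for u
    using monom_ideal_xmon[OF G(1), of u, where 'k = 'k] monom_ideal_xmon[OF G(1), of u, where 'k = 'l]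
    unfolding G(2) by blast
  then show "tspread_strongly_stable n d t (monom_ideal n ?G :: 'l mpol set)"
    using assms G(1) unfolding tspread_strongly_stable_def tspread_ideal_def eq is_monomial_ideal_def
    by auto
qed

theorem corollary5p2:
  fixes n d :: nat and t :: "nat \<Rightarrow> nat" and I :: "'k::field mpol set"
  assumes "d \<ge> 2"
    and "tspread_strongly_stable n d t I"
    and "I \<noteq> poly_ring n"
  shows "(\<forall>i j. betti n I i (i + j) =
            (\<Sum>u\<in>{u \<in> min_gens n I. mdeg u = j}.
               (max_var u - 1 - (\<Sum>l=1..j - 1. t l)) choose i)) \<and>
         (\<forall>i j. betti n (monom_ideal n (min_gens n I) :: 'l::field mpol set) i j = betti n I i j)"
proof (intro conjI allI)
  fix i j
  have "{u \<in> min_gens n I. mdeg u + i = i + j} = {u \<in> min_gens n I. mdeg u = j}" by auto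
  then show "betti n I i (i + j) = (\<Sum>u\<in>{u \<in> min_gens n I. mdeg u = j}.
      (max_var u - 1 - (\<Sum>l=1..j - 1. t l)) choose i)"
    unfolding betti_tspread_strongly_stable[OF assms(2,3)] by (intro sum.cong) auto
next
  fix i j
  let ?J = "monom_ideal n (min_gens n I) :: 'l mpol set"
  have mono: "is_monomial_ideal n I"
    using assms(2) by (auto simp: tspread_strongly_stable_def tspread_ideal_def)
  \<comment> \<open>Both ideals are proper for the same reason: 1 is not a generator.\<close>
  have "?J \<noteq> poly_ring n"
    using assms(3) min_gens(2)[OF mono] monom_ideal_eq_ring_iff[OF min_gens(1)[OF mono], where 'k = 'k]
      monom_ideal_eq_ring_iff[OF min_gens(1)[OF mono], where 'k = 'l] by simp
  then show "betti n ?J i j = betti n I i j"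
    using betti_tspread_strongly_stable[OF tspread_strongly_stable_monom_ideal(1)[OF assms(2), where 'l = 'l]]
    by (simp add: betti_tspread_strongly_stable[OF assms(2,3)]
        tspread_strongly_stable_monom_ideal(2)[OF assms(2), where 'l = 'l])
qed

end
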